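(* Let $p$ be a prime. The canonical projection $\Gamma(p)\to p^{\mathbb Z}\backslash\prod(p)=\mathbb R_+^*/p^{\mathbb Z}$ is an isomorphism in de Rham cohomology. That is, the pull-back from the de Rham complex $C^\infty(\mathbb R_+^*/p^{\mathbb Z})\to C^\infty(\mathbb R_+^*/p^{\mathbb Z})\,\beta$, $h\mapsto (y\partial_yh)\,\beta$, to the leafwise de Rham complex $(\Omega^\bullet,d)$ of $\Gamma(p)$ induces an isomorphism in cohomology.
   Context: $G:=\mathbb A_{\mathbb Q}/(\mathbb Q,+)$ is a compact abelian group, with the injective dense-range homomorphism $a:\mathbb R\to G$, $a(t)=$ class of the adele with zero finite components and archimedean component $t$. The Pontryagin dual of $G$ is $\mathbb Q$: for $q\in\mathbb Q$, $e_q$ is the continuous character of $G$ with $e_q(a(t))=e^{2\pi iqt}$. $\Gamma(p)$ is the quotient of $G\times\mathbb R_+^*$ by the group generated by $(x,y)\mapsto(px,py)$, foliated by the images of $(x+a(\mathbb R))\times\mathbb R_+^*$; $\prod(p)\simeq\mathbb R_+^*$ is the $y$-factor. The algebra $\mathcal A$ of functions on $\Gamma(p)$ consists of the functions $\hat f(x,y)=\sum_{q\in\mathbb Q}f(y,q)e_q(x)$, where $f:\mathbb R_+^*\times\mathbb Q\to\mathbb C$ is smooth in $y$, satisfies $f(py,p^{-1}q)=f(y,q)$ for all $y,q$, and has finite support in $q$, uniformly for $y$ in compact sets. The derivations $X,Y$ of $\mathcal A$ are, in terms of $f$, $X(f)(y,q)=2\pi i\,yq\,f(y,q)$ and $Y(f)(y,q)=y\,\partial_yf(y,q)$;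 they satisfy $[Y,X]=X$. Let $L$ be the Lie algebra with basis $(X,Y)$, and $(\alpha,\beta)$ the dual basis of $L^*$ ($\alpha=y^{-1}dx$, $\beta=y^{-1}dy$). The leafwise de Rham complex is $\Omega^j=\mathcal A\otimes\wedge^jL^*$ with $$df=X(f)\alpha+Y(f)\beta,\qquad d(f\alpha+g\beta)=df\wedge\alpha+f\,d\alpha+dg\wedge\beta,\qquad d\alpha=\alpha\wedge\beta,\quad d\beta=0,$$ and $d=0$ on $\Omega^2$. *)

theory Defs
  imports "HOL-Analysis.Analysis" "HOL-Library.Function_Algebras"
begin

section \<open>The \<open>l\<close>-adic absolute value on the rationals\<close>

definition padic_abs :: "nat \<Rightarrow> rat \<Rightarrow> real" where
  "padic_abs l r = (case quotient_of r of (a, b) \<Rightarrow>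
     if a = 0 then 0
     else real l powi (int (multiplicity (int l) b) - int (multiplicity (int l) a)))"

lemma padic_abs_0 [simp]: "padic_abs l 0 = 0"
  by (simp add: padic_abs_def)

lemma padic_abs_divide:
  assumes "prime l" "a \<noteq> 0" "b \<noteq> 0"
  shows "padic_abs l (of_int a / of_int b) =
    real l powi (int (multiplicity (int l) b) - int (multiplicity (int l) a))"
proof -
  obtain c d where q: "quotient_of (of_int a / of_int b) = (c, d)"
    by fastforce
  have d: "d > 0" using quotient_of_denom_pos[OF q] .
  have eq: "of_int a / of_int b = (of_int c / of_int d :: rat)"
    using quotient_of_div[OF q] .
  hence c: "c \<noteq> 0" using assms d by auto
  from eq have "(of_int (a * d) :: rat) = of_int (c * b)"
    using assms d by (simp add: field_simps)
  hence e: "a * d = c * b" by (simp only: of_int_eq_iff)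
  have pr: "prime_elem (int l)" using assms(1) by (simp add: prime_imp_prime_elem)
  have "multiplicity (int l) (a * d) = multiplicity (int l) (c * b)" by (simp add: e)
  hence "multiplicity (int l) a + multiplicity (int l) d =
      multiplicity (int l) c + multiplicity (int l) b"
    using assms d c by (simp add: prime_elem_multiplicity_mult_distrib[OF pr])
  hence "int (multiplicity (int l) b) - int (multiplicity (int l) a) =
      int (multiplicity (int l) d) - int (multiplicity (int l) c)" by linarith
  thus ?thesis unfolding padic_abs_def by (simp add: q c)
qed

lemma rat_fraction_cases:
  obtains a b where "r = (of_int a / of_int b :: rat)" "b > 0"
  by (metis quotient_of_denom_pos quotient_of_div surj_pair)

lemma padic_abs_nonneg [simp]: "padic_abs l r \<ge> 0"
  by (auto simp: padic_abs_def split: prod.splits)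

lemma padic_abs_eq_0_iff [simp]:
  assumes "prime l"
  shows "padic_abs l r = 0 \<longleftrightarrow> r = 0"
proof -
  obtain a b where r: "r = of_int a / of_int b" "b > 0" by (rule rat_fraction_cases)
  have "l > 0" using assms prime_gt_0_nat by blast
  then show ?thesis using padic_abs_divide[OF assms, of a b] r
    by (cases "a = 0") auto
qed

lemma padic_abs_mult:
  assumes "prime l"
  shows "padic_abs l (r * s) = padic_abs l r * padic_abs l s"
proof -
  obtain a b where r: "r = of_int a / of_int b" "b > 0" by (rule rat_fraction_cases)
  obtain c d where s: "s = of_int c / of_int d" "d > 0" by (rule rat_fraction_cases)
  show ?thesis
  proof (cases "a = 0 \<or> c = 0")
    case True
    then show ?thesis using r s by auto
  next
    case False
    have pr: "prime_elem (int l)" using assms(1) by (simp add: prime_imp_prime_elem)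
    have l: "real l \<noteq> 0" using assms prime_gt_0_nat by fastforce
    have "r * s = of_int (a * c) / of_int (b * d)" using r s by simp
    then have "padic_abs l (r * s) =
        real l powi ((int (multiplicity (int l) b) - int (multiplicity (int l) a))
          + (int (multiplicity (int l) d) - int (multiplicity (int l) c)))"
      using False r s padic_abs_divide[OF assms, of "a * c" "b * d"]
      by (simp add: prime_elem_multiplicity_mult_distrib[OF pr] algebra_simps)
    then show ?thesis
      using False r s padic_abs_divide[OF assms, of a b] padic_abs_divide[OF assms, of c d] l
      by (simp add: power_int_add)
  qed
qed

lemma padic_abs_of_int_le_1:
  assumes "prime l"
  shows "padic_abs l (of_int a) \<le> 1"
proof (cases "a = 0")
  case False
  have l: "real l \<ge> 1" using assms prime_ge_1_nat by auto
  show ?thesis using padic_abs_divide[OF assms False, of 1] l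
    by (simp add: power_int_minus power_int_of_nat inverse_le_1_iff one_le_power)
qed auto

lemma padic_abs_of_int_le_iff:
  assumes "prime l" "a \<noteq> 0"
  shows "padic_abs l (of_int a) \<le> real l powi (- int k) \<longleftrightarrow> int l ^ k dvd a"
proof -
  have l: "real l > 1" using assms prime_gt_1_nat by auto
  have pr: "\<not> is_unit (int l)" using assms by auto
  have "padic_abs l (of_int a) \<le> real l powi (- int k) \<longleftrightarrow> k \<le> multiplicity (int l) a"
    using padic_abs_divide[OF assms, of 1] l
    by (simp add: power_int_minus)
  also have "\<dots> \<longleftrightarrow> int l ^ k dvd a"
    using power_dvd_iff_le_multiplicity[of a "int l" k] assms(2) pr by auto
  finally show ?thesis .
qed

lemma padic_abs_minus [simp]:
  assumes "prime l"
  shows "padic_abs l (- r) = padic_abs l r"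
proof -
  have *: "padic_abs l (-1) = 1"
    using padic_abs_divide[OF assms, of "-1" 1] by (simp add: multiplicity_unit_right)
  have "padic_abs l (- r) = padic_abs l (-1 * r)" by simp
  also have "\<dots> = padic_abs l r" by (simp only: padic_abs_mult[OF assms] * mult_1_left)
  finally show ?thesis .
qed

lemma padic_abs_1 [simp]:
  assumes "prime l"
  shows "padic_abs l 1 = 1"
  using padic_abs_divide[OF assms, of "1" 1] by simp

lemma padic_abs_divide':
  assumes "prime l" "s \<noteq> 0"
  shows "padic_abs l (r / s) = padic_abs l r / padic_abs l s"
  using padic_abs_mult[OF assms(1), of "r / s" s] assms by (simp add: field_simps)

lemma padic_abs_of_int_add:
  assumes "prime l"
  shows "padic_abs l (of_int a + of_int b) \<le> max (padic_abs l (of_int a)) (padic_abs l (of_int b))"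
proof (cases "a = 0 \<or> b = 0 \<or> a + b = 0")
  case True
  then show ?thesis
  proof (elim disjE)
    assume "a + b = 0"
    hence "(of_int a + of_int b :: rat) = 0" by (metis of_int_add of_int_0)
    thus ?thesis by (simp only: padic_abs_0) (simp add: max_def)
  qed auto
next
  case False
  have eq: "padic_abs l (of_int c) = real l powi (- int (multiplicity (int l) c))" if "c \<noteq> 0" for c
    using padic_abs_divide[OF assms that, of 1] by simp
  define k where "k = min (multiplicity (int l) a) (multiplicity (int l) b)"
  have "int l ^ k dvd a" "int l ^ k dvd b"
    by (auto simp: k_def intro!: multiplicity_dvd')
  hence "int l ^ k dvd a + b" by simp
  hence "padic_abs l (of_int (a + b)) \<le> real l powi (- int k)"
    using False by (subst padic_abs_of_int_le_iff[OF assms]) auto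
  also have "\<dots> \<le> max (padic_abs l (of_int a)) (padic_abs l (of_int b))"
    using False by (auto simp: eq k_def min_def)
  finally show ?thesis by simp
qed

lemma padic_abs_add:
  assumes "prime l"
  shows "padic_abs l (r + s) \<le> max (padic_abs l r) (padic_abs l s)"
proof -
  obtain a b where r: "r = of_int a / of_int b" "b > 0" by (rule rat_fraction_cases)
  obtain c d where s: "s = of_int c / of_int d" "d > 0" by (rule rat_fraction_cases)
  have bd: "of_int (b * d) \<noteq> (0 :: rat)" using r s by simp
  let ?m = "padic_abs l (of_int (b * d))"
  have m: "?m > 0" using padic_abs_eq_0_iff[OF assms] bd padic_abs_nonneg
    by (metis order_le_less)
  have e1: "r = of_int (a * d) / of_int (b * d)" and e2: "s = of_int (c * b) / of_int (b * d)"
    and e3: "r + s = (of_int (a * d) + of_int (c * b)) / of_int (b * d)"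
    using r s by (auto simp: field_simps)
  have "padic_abs l (r + s) = padic_abs l (of_int (a * d) + of_int (c * b)) / ?m"
    by (simp only: e3 padic_abs_divide'[OF assms bd])
  also have "\<dots> \<le> max (padic_abs l (of_int (a * d))) (padic_abs l (of_int (c * b))) / ?m"
    using m by (intro divide_right_mono padic_abs_of_int_add assms) auto
  also have "\<dots> = max (padic_abs l r) (padic_abs l s)"
    unfolding padic_abs_divide'[OF assms bd, of "of_int (a * d)", folded e1]
      padic_abs_divide'[OF assms bd, of "of_int (c * b)", folded e2]
    using m by (auto simp: max_def divide_le_cancel)
  finally show ?thesis .
qed

lemma padic_abs_add_le: "prime l \<Longrightarrow> padic_abs l r \<le> e \<Longrightarrow> padic_abs l s \<le> e \<Longrightarrow> padic_abs l (r + s) \<le> e"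
  using padic_abs_add[of l r s] by linarith

lemma padic_abs_add_less: "prime l \<Longrightarrow> padic_abs l r < e \<Longrightarrow> padic_abs l s < e \<Longrightarrow> padic_abs l (r + s) < e"
  using padic_abs_add[of l r s] by linarith

lemma padic_abs_triangle: "prime l \<Longrightarrow> padic_abs l (r + s) \<le> padic_abs l r + padic_abs l s"
  using padic_abs_add[of l r s] padic_abs_nonneg[of l r] padic_abs_nonneg[of l s] by linarith

lemma padic_abs_diff_commute: "prime l \<Longrightarrow> padic_abs l (r - s) = padic_abs l (s - r)"
  using padic_abs_minus[of l "r - s"] by simp

lemma padic_abs_triangle2: 
  assumes "prime l" shows "\<bar>padic_abs l r - padic_abs l s\<bar> \<le> padic_abs l (r - s)"
  using padic_abs_triangle[OF assms, of "r - s" s] padic_abs_triangle[OF assms, of "s - r" r]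
    padic_abs_diff_commute[OF assms, of r s] by simp

lemma padic_abs_le_1_imp_Ints:
  assumes "\<And>l. prime l \<Longrightarrow> padic_abs l r \<le> 1"
  shows "r \<in> \<int>"
proof -
  obtain a b where q: "quotient_of r = (a, b)" by fastforce
  have b: "b > 0" and cop: "coprime a b" and r: "r = of_int a / of_int b"
    using quotient_of_denom_pos[OF q] quotient_of_coprime[OF q] quotient_of_div[OF q] by auto
  have "b = 1"
  proof (rule ccontr)
    assume "b \<noteq> 1"
    hence "nat b \<noteq> 1" using b by auto
    then obtain l where l: "prime l" "l dvd nat b" using prime_factor_nat by blast
    hence lb: "int l dvd b" using b by (metis int_dvd_int_iff int_nat_eq order_less_imp_le)
    have a: "a \<noteq> 0" using cop \<open>b \<noteq> 1\<close> b by auto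
    have "\<not> int l dvd a" using cop lb l(1)
      by (metis not_prime_unit coprime_common_divisor prime_nat_int_transfer)
    hence "multiplicity (int l) a = 0" by (simp add: not_dvd_imp_multiplicity_0)
    moreover have "multiplicity (int l) b > 0" using lb b l(1)
      by (metis not_prime_unit less_irrefl multiplicity_gt_zero_iff prime_nat_int_transfer)
    moreover have "real l > 1" using l prime_gt_1_nat by auto
    ultimately have "padic_abs l r > 1"
      unfolding r using b by (subst padic_abs_divide[OF l(1) a]) (auto simp: power_int_of_nat)
    thus False using assms[OF l(1)] by simp
  qed
  thus ?thesis using r by auto
qed

section \<open>The additive group of adeles\<close>

definition padic_Cauchy :: "nat \<Rightarrow> (nat \<Rightarrow> rat) \<Rightarrow> bool" where
  "padic_Cauchy l u \<longleftrightarrow> (\<forall>e>0. \<exists>N. \<forall>m\<ge>N. \<forall>n\<ge>N. padic_abs l (u m - u n) < e)"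

text \<open>
  An adele is represented by an \<open>l\<close>-adic Cauchy sequence of rationals for every prime \<open>l\<close>
  (a point of \<open>\<rat>\<^sub>l\<close>), together with a real number. Because the \<open>l\<close>-adic absolute value is discrete
  away from \<open>0\<close>, the limit of a Cauchy sequence lies in \<open>\<int>\<^sub>l\<close> iff the sequence eventually has
  absolute value at most \<open>1\<close>. Components at non-prime indices are ignored.
\<close>

definition raw_adele :: "(nat \<Rightarrow> nat \<Rightarrow> rat) \<times> real \<Rightarrow> bool" where
  "raw_adele a \<longleftrightarrow> (\<forall>l. prime l \<longrightarrow> padic_Cauchy l (fst a l)) \<and>
     finite {l. prime l \<and> \<not> (\<forall>\<^sub>F n in sequentially. padic_abs l (fst a l n) \<le> 1)}"

definition adele_rel ::
    "(nat \<Rightarrow> nat \<Rightarrow> rat) \<times> real \<Rightarrow> (nat \<Rightarrow> nat \<Rightarrow> rat) \<times> real \<Rightarrow> bool" where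
  "adele_rel a b \<longleftrightarrow> raw_adele a \<and> raw_adele b \<and> snd a = snd b \<and>
     (\<forall>l. prime l \<longrightarrow> (\<lambda>n. padic_abs l (fst a l n - fst b l n)) \<longlonglongrightarrow> 0)"

lemma padic_null_add:
  assumes "prime l" "(\<lambda>n. padic_abs l (u n)) \<longlonglongrightarrow> 0" "(\<lambda>n. padic_abs l (v n)) \<longlonglongrightarrow> 0"
  shows "(\<lambda>n. padic_abs l (u n + v n)) \<longlonglongrightarrow> 0"
  by (rule tendsto_sandwich[OF _ _ tendsto_const[of 0] tendsto_add_zero[OF assms(2,3)]])
    (auto simp: padic_abs_triangle[OF assms(1)])

lemma padic_Cauchy_add:
  assumes "prime l" "padic_Cauchy l u" "padic_Cauchy l v"
  shows "padic_Cauchy l (\<lambda>n. u n + v n)"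
  unfolding padic_Cauchy_def
proof (intro allI impI)
  fix e :: real assume "e > 0"
  then obtain M N where "\<forall>m\<ge>M. \<forall>n\<ge>M. padic_abs l (u m - u n) < e"
    "\<forall>m\<ge>N. \<forall>n\<ge>N. padic_abs l (v m - v n) < e"
    using assms(2,3) unfolding padic_Cauchy_def by meson
  hence "\<forall>m\<ge>max M N. \<forall>n\<ge>max M N. padic_abs l ((u m - u n) + (v m - v n)) < e"
    by (auto intro!: padic_abs_add_less assms(1))
  thus "\<exists>N. \<forall>m\<ge>N. \<forall>n\<ge>N. padic_abs l (u m + v m - (u n + v n)) < e"
    unfolding add_diff_add[symmetric] by blast
qed

lemma padic_Cauchy_const: "padic_Cauchy l (\<lambda>n. r)"
  by (auto simp: padic_Cauchy_def)

lemma padic_Cauchy_scale: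
  assumes "prime l" "padic_Cauchy l u"
  shows "padic_Cauchy l (\<lambda>n. r * u n)"
proof (cases "r = 0")
  case False
  hence r: "padic_abs l r > 0"
    using padic_abs_eq_0_iff[OF assms(1)] padic_abs_nonneg by (metis order_le_less)
  show ?thesis unfolding padic_Cauchy_def
  proof (intro allI impI)
    fix e :: real assume "e > 0"
    hence "e / padic_abs l r > 0" using r by simp
    then obtain N where "\<forall>m\<ge>N. \<forall>n\<ge>N. padic_abs l (u m - u n) < e / padic_abs l r"
      using assms(2) unfolding padic_Cauchy_def by meson
    hence "\<forall>m\<ge>N. \<forall>n\<ge>N. padic_abs l (r * (u m - u n)) < e"
      using r by (simp add: padic_abs_mult[OF assms(1)] pos_less_divide_eq mult.commute)
    thus "\<exists>N. \<forall>m\<ge>N. \<forall>n\<ge>N. padic_abs l (r * u m - r * u n) < e"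
      unfolding right_diff_distrib by blast
  qed
qed (auto simp: padic_Cauchy_const)

lemma finite_bad_primes_of_rat: "finite {l. prime l \<and> padic_abs l r > 1}"
proof -
  obtain a b where r: "r = of_int a / of_int b" "b > 0" by (rule rat_fraction_cases)
  have "{l. prime l \<and> padic_abs l r > 1} \<subseteq> {l. l dvd nat b}"
  proof (intro subsetI CollectI, elim CollectE conjE, rule ccontr)
    fix l assume l: "prime l" "padic_abs l r > 1" "\<not> l dvd nat b"
    hence "\<not> int l dvd b" using r(2) by (metis int_dvd_int_iff int_nat_eq order_less_imp_le)
    hence "multiplicity (int l) b = 0" by (simp add: not_dvd_imp_multiplicity_0)
    hence "padic_abs l (of_int b) = 1" using padic_abs_divide[OF l(1), of b 1] r(2) by simp
    hence "padic_abs l r = padic_abs l (of_int a)"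
      using r padic_abs_divide'[OF l(1), of "of_int b" "of_int a"] by simp
    thus False using padic_abs_of_int_le_1[OF l(1), of a] l(2) by simp
  qed
  moreover have "finite {l. l dvd nat b}" using r(2) by simp
  ultimately show ?thesis by (rule finite_subset)
qed

lemma raw_adele_add:
  assumes "raw_adele a" "raw_adele b"
  shows "raw_adele (\<lambda>l n. fst a l n + fst b l n, t)"
proof -
  let ?B = "\<lambda>a. {l. prime l \<and> \<not> (\<forall>\<^sub>F n in sequentially. padic_abs l (fst a l n) \<le> 1)}"
  have "?B (\<lambda>l n. fst a l n + fst b l n, t) \<subseteq> ?B a \<union> ?B b"
  proof (rule subsetI, rule ccontr)
    fix l assume l: "l \<in> ?B (\<lambda>l n. fst a l n + fst b l n, t)" and "l \<notin> ?B a \<union> ?B b"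
    hence "\<forall>\<^sub>F n in sequentially. padic_abs l (fst a l n) \<le> 1"
      "\<forall>\<^sub>F n in sequentially. padic_abs l (fst b l n) \<le> 1" by auto
    hence "\<forall>\<^sub>F n in sequentially. padic_abs l (fst a l n + fst b l n) \<le> 1"
      by eventually_elim (use l in \<open>auto intro: padic_abs_add_le\<close>)
    with l show False by simp
  qed
  hence "finite (?B (\<lambda>l n. fst a l n + fst b l n, t))"
    using assms unfolding raw_adele_def by (meson finite_Un finite_subset)
  with assms show ?thesis unfolding raw_adele_def by (auto intro: padic_Cauchy_add)
qed

lemma raw_adele_const: "raw_adele (\<lambda>l n. r, t)"
proof -
  have "{l. prime l \<and> \<not> (\<forall>\<^sub>F n in sequentially. padic_abs l r \<le> 1)} \<subseteq> {l. prime l \<and> padic_abs l r > 1}"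
    by (auto simp: not_le)
  hence "finite {l. prime l \<and> \<not> (\<forall>\<^sub>F n in sequentially. padic_abs l r \<le> 1)}"
    by (rule finite_subset[OF _ finite_bad_primes_of_rat])
  thus ?thesis by (simp add: raw_adele_def padic_Cauchy_const)
qed

lemma raw_adele_scale:
  assumes "raw_adele a"
  shows "raw_adele (\<lambda>l n. r * fst a l n, t)"
proof -
  let ?B = "\<lambda>a. {l. prime l \<and> \<not> (\<forall>\<^sub>F n in sequentially. padic_abs l (fst a l n) \<le> 1)}"
  have "?B (\<lambda>l n. r * fst a l n, t) \<subseteq> ?B a \<union> {l. prime l \<and> padic_abs l r > 1}"
  proof (rule subsetI, rule ccontr)
    fix l assume l: "l \<in> ?B (\<lambda>l n. r * fst a l n, t)"
      and "l \<notin> ?B a \<union> {l. prime l \<and> padic_abs l r > 1}"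
    hence r: "padic_abs l r \<le> 1" and "\<forall>\<^sub>F n in sequentially. padic_abs l (fst a l n) \<le> 1"
      by auto
    from this(2) have "\<forall>\<^sub>F n in sequentially. padic_abs l (r * fst a l n) \<le> 1"
    proof eventually_elim
      case (elim n)
      have "prime l" using l by simp
      thus ?case using elim r by (simp add: padic_abs_mult mult_le_one)
    qed
    with l show False by simp
  qed
  moreover have "finite (?B a \<union> {l. prime l \<and> padic_abs l r > 1})"
    using assms finite_bad_primes_of_rat by (simp add: raw_adele_def)
  ultimately have "finite (?B (\<lambda>l n. r * fst a l n, t))" by (rule finite_subset)
  with assms show ?thesis unfolding raw_adele_def by (auto intro: padic_Cauchy_scale)
qed

lemma adele_rel_refl: "raw_adele a \<Longrightarrow> adele_rel a a"
  by (simp add: adele_rel_def)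

quotient_type adele = "(nat \<Rightarrow> nat \<Rightarrow> rat) \<times> real" / partial: adele_rel
proof (rule part_equivpI)
  show "\<exists>a. adele_rel a a"
    using adele_rel_refl[OF raw_adele_const[of 0 0]] by blast
  show "symp adele_rel"
    by (rule sympI) (auto simp: adele_rel_def padic_abs_diff_commute)
  show "transp adele_rel"
  proof (rule transpI)
    fix a b c assume ab: "adele_rel a b" and bc: "adele_rel b c"
    have "(\<lambda>n. padic_abs l (fst a l n - fst c l n)) \<longlonglongrightarrow> 0" if "prime l" for l
      using padic_null_add[OF that, of "\<lambda>n. fst a l n - fst b l n" "\<lambda>n. fst b l n - fst c l n"]
        ab bc that by (simp add: adele_rel_def)
    with ab bc show "adele_rel a c" by (simp add: adele_rel_def)
  qed
qed

instantiation adele :: ab_group_add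
begin

lift_definition zero_adele :: adele is "(\<lambda>l n. 0, 0)"
  by (intro adele_rel_refl raw_adele_const)

lift_definition plus_adele :: "adele \<Rightarrow> adele \<Rightarrow> adele"
  is "\<lambda>a b. (\<lambda>l n. fst a l n + fst b l n, snd a + snd b)"
proof -
  fix a a' b b' assume *: "adele_rel a a'" "adele_rel b b'"
  have "(\<lambda>n. padic_abs l (fst a l n + fst b l n - (fst a' l n + fst b' l n))) \<longlonglongrightarrow> 0"
    if "prime l" for l
    using padic_null_add[OF that, of "\<lambda>n. fst a l n - fst a' l n" "\<lambda>n. fst b l n - fst b' l n"]
      * that by (simp add: adele_rel_def algebra_simps)
  with * show "adele_rel (\<lambda>l n. fst a l n + fst b l n, snd a + snd b)
      (\<lambda>l n. fst a' l n + fst b' l n, snd a' + snd b')"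
    by (simp add: adele_rel_def raw_adele_add)
qed

lift_definition uminus_adele :: "adele \<Rightarrow> adele"
  is "\<lambda>a. (\<lambda>l n. - fst a l n, - snd a)"
proof -
  fix a a' assume *: "adele_rel a a'"
  have "padic_abs l (fst a' l n - fst a l n) = padic_abs l (fst a l n - fst a' l n)"
    if "prime l" for l n using that by (rule padic_abs_diff_commute)
  with * show "adele_rel (\<lambda>l n. - fst a l n, - snd a) (\<lambda>l n. - fst a' l n, - snd a')"
    using raw_adele_scale[of _ "-1"] by (simp add: adele_rel_def)
qed

definition minus_adele :: "adele \<Rightarrow> adele \<Rightarrow> adele" where
  "minus_adele x y = x + (- y)"

instance
proof
  fix x y z :: adele
  show "x + y + z = x + (y + z)"
  proof (transfer, goal_cases)
    case (1 x y z)
    hence "raw_adele x" "raw_adele y" "raw_adele z" by (simp_all add: adele_rel_def)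
    hence "raw_adele (\<lambda>l n. fst x l n + fst y l n + fst z l n, snd x + snd y + snd z)"
      using raw_adele_add[of "(\<lambda>l n. fst x l n + fst y l n, snd x + snd y)" z] raw_adele_add
      by simp
    from adele_rel_refl[OF this] show ?case by (simp only: fst_conv snd_conv add.assoc)
  qed
  show "x + y = y + x"
    by transfer (simp add: adele_rel_def raw_adele_add add.commute)
  show "0 + x = x"
    by transfer (simp add: adele_rel_def)
  show "- x + x = 0"
    by transfer (simp add: adele_rel_def raw_adele_const)
  show "x - y = x + (- y)" by (simp add: minus_adele_def)
qed

end

lift_definition adele_scale :: "rat \<Rightarrow> adele \<Rightarrow> adele"
  is "\<lambda>r a. (\<lambda>l n. r * fst a l n, of_rat r * snd a)"
proof -
  fix r a a' assume *: "adele_rel a a'"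
  have "(\<lambda>n. padic_abs l (r * fst a l n - r * fst a' l n)) \<longlonglongrightarrow> 0" if l: "prime l" for l
    using tendsto_mult_right_zero[of "\<lambda>n. padic_abs l (fst a l n - fst a' l n)" sequentially "padic_abs l r"]
      * l unfolding right_diff_distrib[symmetric] padic_abs_mult[OF l] by (simp add: adele_rel_def)
  with * show "adele_rel (\<lambda>l n. r * fst a l n, of_rat r * snd a)
      (\<lambda>l n. r * fst a' l n, of_rat r * snd a')"
    by (simp add: adele_rel_def raw_adele_scale)
qed

lift_definition adele_of_rat :: "rat \<Rightarrow> adele" is "\<lambda>r. (\<lambda>l n. r, of_rat r)"
  by (intro adele_rel_refl raw_adele_const)

lift_definition adele_of_real :: "real \<Rightarrow> adele" is "\<lambda>t. (\<lambda>l n. 0, t)"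
  by (intro adele_rel_refl raw_adele_const)

lift_definition adele_real :: "adele \<Rightarrow> real" is snd
  by (simp add: adele_rel_def)

text \<open>The \<open>l\<close>-adic absolute value of the component at a prime \<open>l\<close>.\<close>

lift_definition adele_abs :: "nat \<Rightarrow> adele \<Rightarrow> real"
  is "\<lambda>l a. if prime l then lim (\<lambda>n. padic_abs l (fst a l n)) else 0"
proof -
  fix l a a' assume *: "adele_rel a a'"
  have "lim (\<lambda>n. padic_abs l (fst a l n)) = lim (\<lambda>n. padic_abs l (fst a' l n))" if l: "prime l"
  proof -
    have "(\<lambda>n. padic_abs l (fst a l n - fst a' l n)) \<longlonglongrightarrow> 0"
      using * l by (simp add: adele_rel_def)
    hence 0: "(\<lambda>n. padic_abs l (fst a l n) - padic_abs l (fst a' l n)) \<longlonglongrightarrow> 0"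
      by (rule Lim_null_comparison[rotated])
        (simp only: real_norm_def padic_abs_triangle2[OF l] eventually_True)
    have "(\<lambda>n. padic_abs l (fst a l n)) \<longlonglongrightarrow> L \<longleftrightarrow> (\<lambda>n. padic_abs l (fst a' l n)) \<longlonglongrightarrow> L" for L
      using tendsto_diff[OF _ 0, of "\<lambda>n. padic_abs l (fst a l n)" L]
        tendsto_add[OF _ 0, of "\<lambda>n. padic_abs l (fst a' l n)" L] by auto
    thus ?thesis by (simp add: lim_def)
  qed
  thus "(if prime l then lim (\<lambda>n. padic_abs l (fst a l n)) else 0) =
      (if prime l then lim (\<lambda>n. padic_abs l (fst a' l n)) else 0)" by simp
qed

lemma padic_abs_power: "prime l \<Longrightarrow> padic_abs l (r ^ n) = padic_abs l r ^ n"
  by (induction n) (simp_all add: padic_abs_mult)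

lemma padic_abs_of_int_unit:
  assumes "prime l" "\<not> int l dvd a"
  shows "padic_abs l (of_int a) = 1"
proof -
  have "a \<noteq> 0" using assms by auto
  thus ?thesis using padic_abs_divide[OF assms(1), of a 1] assms(2)
    by (simp add: not_dvd_imp_multiplicity_0)
qed

lemma padic_abs_self:
  assumes "prime l"
  shows "padic_abs l (of_int (int l)) = inverse (real l)"
proof -
  have l: "int l \<noteq> 0" "\<not> is_unit (int l)" using assms by auto
  show ?thesis using padic_abs_divide[OF assms l(1), of 1] l
    by (simp add: power_int_minus multiplicity_self)
qed

lemma rat_approx_integral_elsewhere:
  assumes l: "prime l" and e: "e > 0"
  obtains w where "padic_abs l (v - w) < e"
    "\<And>m. prime m \<Longrightarrow> m \<noteq> l \<Longrightarrow> padic_abs m w \<le> 1"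
proof -
  obtain a b where v: "v = of_int a / of_int b" "b > 0" by (rule rat_fraction_cases)
  have lp: "int l \<noteq> 0" "\<not> is_unit (int l)" using l by auto
  define k where "k = multiplicity (int l) b"
  obtain b' where b': "b = int l ^ k * b'" "\<not> int l dvd b'"
    unfolding k_def using multiplicity_decompose'[of b "int l"] v(2) lp by (metis less_irrefl)
  have l1: "real l > 1" using prime_gt_1_nat[OF l] by simp
  obtain K where K: "real l ^ k / e < real l ^ K" using real_arch_pow[OF l1] by blast
  have "coprime (int l) b'" using b'(2) l by (simp add: prime_imp_coprime)
  hence "coprime b' (int l ^ K)" by (simp add: coprime_commute)
  then obtain u y where uy: "u * b' + y * int l ^ K = 1"
    using bezout_int[of b' "int l ^ K"] by auto
  define L :: rat where "L = of_int (int l)"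
  have L0: "L \<noteq> 0" and b0: "(of_int b' :: rat) \<noteq> 0" using lp b'(2) by (auto simp: L_def)
  define w :: rat where "w = of_int (a * u) / L ^ k"
  have eq: "(1 :: rat) - of_int u * of_int b' = of_int y * L ^ K"
  proof -
    have "(of_int (u * b' + y * int l ^ K) :: rat) = of_int 1" by (simp only: uy)
    hence "of_int u * of_int b' + of_int y * L ^ K = 1"
      unfolding L_def of_int_add of_int_mult of_int_power of_int_1 .
    thus ?thesis by linarith
  qed
  have "v - w = of_int a * (1 - of_int u * of_int b') / (L ^ k * of_int b')"
  proof -
    have *: "x / (c * d) - x * z / c = x * (1 - z * d) / (c * d)" if "c \<noteq> 0" "d \<noteq> 0" for x z c d :: rat
      using that by (simp add: field_simps)
    have B: "of_int b = L ^ k * of_int b'" unfolding L_def b'(1) by (simp only: of_int_mult of_int_power)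
    show ?thesis unfolding v(1) w_def B of_int_mult by (rule *) (use L0 b0 in simp_all)
  qed
  also have "\<dots> = of_int (a * y) * L ^ K / (L ^ k * of_int b')" unfolding eq by simp
  finally have "padic_abs l (v - w) = padic_abs l (of_int (a * y)) * inverse (real l) ^ K / inverse (real l) ^ k"
    using L0 b0 padic_abs_of_int_unit[OF l b'(2)]
    by (simp del: of_int_mult add: padic_abs_divide'[OF l] padic_abs_mult[OF l]
      padic_abs_power[OF l] padic_abs_self[OF l, folded L_def])
  also have "\<dots> \<le> 1 * inverse (real l) ^ K / inverse (real l) ^ k"
    by (intro divide_right_mono mult_right_mono padic_abs_of_int_le_1 l) auto
  also have "\<dots> < e" using K e l1 by (simp add: field_simps)
  finally have 1: "padic_abs l (v - w) < e" .
  have 2: "padic_abs m w \<le> 1" if m: "prime m" "m \<noteq> l" for m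
  proof -
    have "\<not> m dvd l" using m l primes_dvd_imp_eq by blast
    hence "\<not> int m dvd int l" by simp
    hence "padic_abs m L = 1" unfolding L_def by (rule padic_abs_of_int_unit[OF m(1)])
    thus ?thesis unfolding w_def using L0 padic_abs_of_int_le_1[OF m(1), of "a * u"]
      by (simp add: padic_abs_divide'[OF m(1)] padic_abs_power[OF m(1)])
  qed
  show thesis using 1 2 that by blast
qed

lemma raw_adele_abs_convergent:
  assumes "raw_adele a" "prime l"
  shows "(\<lambda>n. padic_abs l (fst a l n)) \<longlonglongrightarrow> lim (\<lambda>n. padic_abs l (fst a l n))"
proof -
  have C: "padic_Cauchy l (fst a l)" using assms by (simp add: raw_adele_def)
  have "Cauchy (\<lambda>n. padic_abs l (fst a l n))"
  proof (rule metric_CauchyI)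
    fix e :: real assume "e > 0"
    then obtain N where "\<forall>m\<ge>N. \<forall>n\<ge>N. padic_abs l (fst a l m - fst a l n) < e"
      using C unfolding padic_Cauchy_def by meson
    thus "\<exists>N. \<forall>m\<ge>N. \<forall>n\<ge>N. dist (padic_abs l (fst a l m)) (padic_abs l (fst a l n)) < e"
      unfolding dist_real_def using padic_abs_triangle2[OF assms(2)] le_less_trans by blast
  qed
  thus ?thesis by (simp add: Cauchy_convergent_iff convergent_LIMSEQ_iff)
qed

lemma adele_abs_nonprime: "\<not> prime l \<Longrightarrow> adele_abs l x = 0"
  by transfer simp

lemma adele_abs_nonneg: "adele_abs l x \<ge> 0"
proof (transfer, goal_cases)
  case (1 l x)
  show ?case
  proof (cases "prime l")
    case True
    have "raw_adele x" using 1 by (simp add: adele_rel_def)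
    have "0 \<le> lim (\<lambda>n. padic_abs l (fst x l n))"
      by (rule LIMSEQ_le_const[OF raw_adele_abs_convergent[OF \<open>raw_adele x\<close> True]])
        (intro exI allI impI padic_abs_nonneg)
    with True show ?thesis by (simp only: if_True)
  qed simp
qed

lemma adele_abs_add: "adele_abs l (x + y) \<le> max (adele_abs l x) (adele_abs l y)"
proof (transfer, goal_cases)
  case (1 l x y)
  hence r: "raw_adele x" "raw_adele y" by (simp_all add: adele_rel_def)
  show ?case
  proof (cases "prime l")
    case l: True
    let ?z = "(\<lambda>l n. fst x l n + fst y l n, snd x + snd y)"
    have "lim (\<lambda>n. padic_abs l (fst ?z l n))
        \<le> max (lim (\<lambda>n. padic_abs l (fst x l n))) (lim (\<lambda>n. padic_abs l (fst y l n)))"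
      by (rule LIMSEQ_le[OF raw_adele_abs_convergent[OF raw_adele_add[OF r] l]
        tendsto_max[OF raw_adele_abs_convergent[OF r(1) l] raw_adele_abs_convergent[OF r(2) l]]])
        (simp only: fst_conv padic_abs_add[OF l] simp_thms)
    with l show ?thesis by simp
  qed simp
qed

lemma adele_abs_minus: "adele_abs l (- x) = adele_abs l x"
  by transfer simp

lemma adele_abs_of_rat: "prime l \<Longrightarrow> adele_abs l (adele_of_rat r) = padic_abs l r"
  by transfer simp

lemma adele_abs_of_real: "adele_abs l (adele_of_real t) = 0"
  by transfer simp

lemma adele_real_add: "adele_real (x + y) = adele_real x + adele_real y"
  by transfer simp

lemma adele_real_minus: "adele_real (- x) = - adele_real x"
  by transfer simp

lemma adele_real_diff: "adele_real (x - y) = adele_real x - adele_real y"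
  unfolding minus_adele_def adele_real_add adele_real_minus by simp

lemma adele_real_of_rat: "adele_real (adele_of_rat r) = of_rat r"
  by transfer simp

lemma adele_real_of_real: "adele_real (adele_of_real t) = t"
  by transfer simp

lemma adele_of_rat_add: "adele_of_rat (r + s) = adele_of_rat r + adele_of_rat s"
  by transfer (simp add: adele_rel_def raw_adele_const of_rat_add)

lemma adele_of_rat_minus: "adele_of_rat (- r) = - adele_of_rat r"
  by transfer (simp add: adele_rel_def raw_adele_const of_rat_minus)

lemma adele_of_rat_0: "adele_of_rat 0 = 0"
  by transfer (simp add: adele_rel_def raw_adele_const)

lemma adele_of_rat_diff: "adele_of_rat (r - s) = adele_of_rat r - adele_of_rat s"
  using adele_of_rat_add[of r "- s"] by (simp add: adele_of_rat_minus)

lemma adele_of_real_add: "adele_of_real (r + s) = adele_of_real r + adele_of_real s"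
  by transfer (simp add: adele_rel_def raw_adele_const)

lemma adele_scale_add: "adele_scale r (x + y) = adele_scale r x + adele_scale r y"
proof (transfer, goal_cases)
  case (1 r x y)
  hence "raw_adele x" "raw_adele y" by (simp_all add: adele_rel_def)
  from adele_rel_refl[OF raw_adele_scale[OF raw_adele_add[OF this]]]
  show ?case by (simp only: fst_conv snd_conv distrib_left)
qed

lemma adele_scale_of_rat: "adele_scale r (adele_of_rat s) = adele_of_rat (r * s)"
  by transfer (simp add: adele_rel_def raw_adele_const of_rat_mult)

lemma adele_scale_diff: "adele_scale r (x - y) = adele_scale r x - adele_scale r y"
  using adele_scale_add[of r "x - y" y] by (simp add: algebra_simps)

lemma finite_adele_bad_primes: "finite {l. prime l \<and> adele_abs l x > 1}"
proof (transfer, goal_cases)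
  case (1 x)
  hence r: "raw_adele x" by (simp_all add: adele_rel_def)
  let ?E = "\<lambda>l. \<forall>\<^sub>F n in sequentially. padic_abs l (fst x l n) \<le> 1"
  have le: "lim (\<lambda>n. padic_abs l (fst x l n)) \<le> 1" if "prime l" "?E l" for l
    by (rule tendsto_upperbound[OF raw_adele_abs_convergent[OF r that(1)] that(2)]) simp
  have "finite {l. prime l \<and> \<not> ?E l}" using r unfolding raw_adele_def by (rule conjunct2)
  thus ?case
  proof (rule finite_subset[rotated], intro subsetI CollectI conjI notI)
    fix l :: nat
    assume l: "l \<in> {l. prime l \<and> 1 < (if prime l then lim (\<lambda>n. padic_abs l (fst x l n)) else 0)}"
    thus p: "prime l" by simp
    assume "?E l"
    have "1 < lim (\<lambda>n. padic_abs l (fst x l n))" using l p by (simp only: mem_Collect_eq if_True)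
    with le[OF p \<open>?E l\<close>] show False by linarith
  qed
qed

lemma adele_rat_approx:
  assumes "prime l" "e > 0"
  shows "\<exists>r. adele_abs l (x - adele_of_rat r) < e"
  unfolding minus_adele_def using assms
proof (transfer, goal_cases)
  case (1 l e x)
  hence r: "raw_adele x" by (simp_all add: adele_rel_def)
  have "padic_Cauchy l (fst x l)" using r 1 by (simp add: raw_adele_def)
  moreover have e2: "e / 2 > 0" using 1 by simp
  ultimately obtain N where N: "\<forall>m\<ge>N. \<forall>n\<ge>N. padic_abs l (fst x l m - fst x l n) < e / 2"
    unfolding padic_Cauchy_def by blast
  let ?y = "(\<lambda>k n. fst x k n + - fst x l N, snd x + - of_rat (fst x l N))"
  have y: "raw_adele ?y"
    using raw_adele_add[OF r raw_adele_const[of "- fst x l N"]] by simp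
  have "\<forall>\<^sub>F n in sequentially. padic_abs l (fst ?y l n) \<le> e / 2"
    unfolding eventually_sequentially
  proof (intro exI allI impI)
    fix n assume "N \<le> n"
    with N have "padic_abs l (fst x l n - fst x l N) < e / 2" by blast
    thus "padic_abs l (fst ?y l n) \<le> e / 2" by simp
  qed
  hence "lim (\<lambda>n. padic_abs l (fst ?y l n)) \<le> e / 2"
    by (intro tendsto_upperbound[OF raw_adele_abs_convergent[OF y \<open>prime l\<close>]]) simp_all
  with e2 have "lim (\<lambda>n. padic_abs l (fst ?y l n)) < e" by linarith
  with \<open>prime l\<close> show ?case
    by (intro exI[of _ "fst x l N"]) (simp only: fst_conv snd_conv if_True)
qed

lemma adele_abs_diff_le:
  "adele_abs l (x - y) \<le> e \<Longrightarrow> adele_abs l (y - z) \<le> e \<Longrightarrow> adele_abs l (x - z) \<le> e"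
  using adele_abs_add[of l "x - y" "y - z"] by simp

lemma adele_abs_diff_commute: "adele_abs l (x - y) = adele_abs l (y - x)"
  using adele_abs_minus[of l "x - y"] by simp

lemma padic_abs_sum_le:
  assumes "prime l" "\<And>i. i \<in> I \<Longrightarrow> padic_abs l (f i) \<le> e" "e \<ge> 0"
  shows "padic_abs l (sum f I) \<le> e"
  using assms(2) by (induction I rule: infinite_finite_induct)
    (auto simp: assms(3) intro!: padic_abs_add_le[OF assms(1)])

text \<open>Strong approximation: modulo any \<open>N \<noteq> 0\<close>, a finite adele is approximated by a rational.\<close>

lemma adele_strong_approx:
  assumes N: "N \<noteq> 0"
  obtains s where "\<And>l. prime l \<Longrightarrow> adele_abs l (x - adele_of_rat s) \<le> padic_abs l (of_int N)"
proof -
  define F where "F = {l. prime l \<and> (adele_abs l x > 1 \<or> int l dvd N)}"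
  have "{l. int l dvd N} \<subseteq> {..nat \<bar>N\<bar>}" using N by (auto dest!: dvd_imp_le_int)
  hence "finite {l. int l dvd N}" by (rule finite_subset) simp
  hence "finite ({l. prime l \<and> adele_abs l x > 1} \<union> {l. int l dvd N})"
    using finite_adele_bad_primes[of x] by simp
  hence F: "finite F" by (rule finite_subset[rotated]) (auto simp: F_def)
  have pos: "padic_abs l (of_int N) > 0" if "prime l" for l
    using N padic_abs_eq_0_iff[OF that, of "of_int N"] padic_abs_nonneg[of l "of_int N"]
    by (metis of_int_eq_0_iff order_le_less)
  have "\<exists>w. adele_abs l (x - adele_of_rat w) \<le> padic_abs l (of_int N) \<and>
      (\<forall>m. prime m \<longrightarrow> m \<noteq> l \<longrightarrow> padic_abs m w \<le> padic_abs m (of_int N))"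
    if l: "prime l" for l
  proof -
    obtain u where u: "adele_abs l (x - adele_of_rat u) < padic_abs l (of_int N)"
      using adele_rat_approx[OF l pos[OF l]] by blast
    obtain w where w: "padic_abs l (u / of_int N - w) < 1"
      "\<And>m. prime m \<Longrightarrow> m \<noteq> l \<Longrightarrow> padic_abs m w \<le> 1"
      using rat_approx_integral_elsewhere[OF l, of 1 "u / of_int N"] by auto
    have "u - w * of_int N = (u / of_int N - w) * of_int N" using N by (simp add: field_simps)
    hence "padic_abs l (u - w * of_int N) \<le> padic_abs l (of_int N)"
      using w(1) pos[OF l] by (simp add: padic_abs_mult[OF l])
    hence "adele_abs l (adele_of_rat u - adele_of_rat (w * of_int N)) \<le> padic_abs l (of_int N)"
      by (simp add: adele_of_rat_diff[symmetric] adele_abs_of_rat[OF l])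
    hence "adele_abs l (x - adele_of_rat (w * of_int N)) \<le> padic_abs l (of_int N)"
      using adele_abs_diff_le u less_imp_le by blast
    moreover have "padic_abs m (w * of_int N) \<le> padic_abs m (of_int N)"
      if "prime m" "m \<noteq> l" for m
      using w(2)[OF that] pos[OF that(1)] by (simp add: padic_abs_mult[OF that(1)])
    ultimately show ?thesis by blast
  qed
  hence "\<exists>w. \<forall>l. prime l \<longrightarrow> adele_abs l (x - adele_of_rat (w l)) \<le> padic_abs l (of_int N) \<and>
      (\<forall>m. prime m \<longrightarrow> m \<noteq> l \<longrightarrow> padic_abs m (w l) \<le> padic_abs m (of_int N))"
    by (intro choice) blast
  then obtain w where w1: "\<And>l. prime l \<Longrightarrow> adele_abs l (x - adele_of_rat (w l)) \<le> padic_abs l (of_int N)"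
    and w2: "\<And>l m. prime l \<Longrightarrow> prime m \<Longrightarrow> m \<noteq> l \<Longrightarrow> padic_abs m (w l) \<le> padic_abs m (of_int N)"
    by blast
  show thesis
  proof (rule that)
    fix l :: nat assume l: "prime l"
    show "adele_abs l (x - adele_of_rat (sum w F)) \<le> padic_abs l (of_int N)"
    proof (cases "l \<in> F")
      case True
      have "padic_abs l (w l - sum w F) = padic_abs l (sum w (F - {l}))"
        using True F padic_abs_minus[OF l, of "sum w (F - {l})"] by (simp add: sum_diff1)
      also have "\<dots> \<le> padic_abs l (of_int N)"
        by (rule padic_abs_sum_le[OF l]) (use w2 l in \<open>auto simp: F_def\<close>)
      finally have "adele_abs l (adele_of_rat (w l) - adele_of_rat (sum w F)) \<le> padic_abs l (of_int N)"
        by (simp add: adele_of_rat_diff[symmetric] adele_abs_of_rat[OF l])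
      with w1[OF l] show ?thesis by (rule adele_abs_diff_le)
    next
      case False
      hence n: "padic_abs l (of_int N) = 1" and x: "adele_abs l x \<le> 1"
        using l padic_abs_of_int_unit[OF l] by (auto simp: F_def)
      have "padic_abs l (sum w F) \<le> 1"
        by (rule padic_abs_sum_le[OF l]) (use w2[of _ l] l n False in \<open>auto simp: F_def\<close>)
      hence 2: "adele_abs l (0 - adele_of_rat (sum w F)) \<le> 1"
        by (simp add: adele_abs_minus adele_abs_of_rat[OF l])
      have "adele_abs l (x - 0) \<le> 1" using x by simp
      from this 2 show ?thesis unfolding n by (rule adele_abs_diff_le)
    qed
  qed
qed

text \<open>
  The restricted product topology: since \<open>x\<^sub>l + \<int>\<^sub>l\<close> is \<open>\<int>\<^sub>l\<close> for almost all primes \<open>l\<close> and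
  is always open in \<open>\<rat>\<^sub>l\<close>, the following sets form a neighbourhood basis at \<open>x\<close>.
\<close>

definition adele_nbhd :: "nat set \<Rightarrow> real \<Rightarrow> adele \<Rightarrow> adele set" where
  "adele_nbhd F e x = {z. (\<forall>l. prime l \<longrightarrow> adele_abs l (z - x) \<le> 1) \<and>
     (\<forall>l\<in>F. prime l \<longrightarrow> adele_abs l (z - x) < e) \<and> \<bar>adele_real z - adele_real x\<bar> < e}"

instantiation adele :: topological_space
begin

definition open_adele :: "adele set \<Rightarrow> bool" where
  "open_adele S \<longleftrightarrow> (\<forall>x\<in>S. \<exists>F e. finite F \<and> e > 0 \<and> adele_nbhd F e x \<subseteq> S)"

instance
proof
  show "open (UNIV :: adele set)"
    unfolding open_adele_def by (metis finite.emptyI subset_UNIV zero_less_one)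
next
  fix S T :: "adele set" assume S: "open S" "open T"
  show "open (S \<inter> T)" unfolding open_adele_def
  proof
    fix x assume x: "x \<in> S \<inter> T"
    obtain F e where 1: "finite F" "e > 0" "adele_nbhd F e x \<subseteq> S"
      using x S unfolding open_adele_def by blast
    obtain G d where 2: "finite G" "d > 0" "adele_nbhd G d x \<subseteq> T"
      using x S unfolding open_adele_def by blast
    have "adele_nbhd (F \<union> G) (min e d) x \<subseteq> adele_nbhd F e x \<inter> adele_nbhd G d x"
      by (auto simp: adele_nbhd_def)
    with 1 2 show "\<exists>F e. finite F \<and> e > 0 \<and> adele_nbhd F e x \<subseteq> S \<inter> T"
      by (intro exI[of _ "F \<union> G"] exI[of _ "min e d"]) auto
  qed
next
  fix K :: "adele set set" assume "\<forall>S\<in>K. open S"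
  thus "open (\<Union> K)" unfolding open_adele_def by (meson Union_iff Sup_upper subset_trans)
qed

end

section \<open>The adele class group and its characters\<close>

quotient_type adele_class = adele / "\<lambda>x y. \<exists>r. x - y = adele_of_rat r"
proof (rule equivpI)
  show "reflp (\<lambda>x y. \<exists>r. x - y = adele_of_rat r)"
    by (rule reflpI) (auto intro!: exI[of _ 0] simp: adele_of_rat_0)
  show "symp (\<lambda>x y. \<exists>r. x - y = adele_of_rat r)"
  proof (rule sympI)
    fix x y :: adele assume "\<exists>r. x - y = adele_of_rat r"
    then obtain r where "x - y = adele_of_rat r" ..
    hence "y - x = adele_of_rat (- r)" by (metis adele_of_rat_minus minus_diff_eq)
    thus "\<exists>r. y - x = adele_of_rat r" ..
  qed
  show "transp (\<lambda>x y. \<exists>r. x - y = adele_of_rat r)"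
  proof (rule transpI)
    fix x y z :: adele assume "\<exists>r. x - y = adele_of_rat r" "\<exists>r. y - z = adele_of_rat r"
    then obtain r s where "x - y = adele_of_rat r" "y - z = adele_of_rat s" by blast
    moreover have "x - z = (x - y) + (y - z)" by simp
    ultimately have "x - z = adele_of_rat (r + s)" by (simp only: adele_of_rat_add)
    thus "\<exists>r. x - z = adele_of_rat r" ..
  qed
qed

instantiation adele_class :: ab_group_add
begin

lift_definition zero_adele_class :: adele_class is 0 .

lift_definition plus_adele_class :: "adele_class \<Rightarrow> adele_class \<Rightarrow> adele_class" is "(+)"
proof -
  fix x x' y y' :: adele
  assume "\<exists>r. x - x' = adele_of_rat r" "\<exists>r. y - y' = adele_of_rat r"
  then obtain r s where "x - x' = adele_of_rat r" "y - y' = adele_of_rat s" by blast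
  hence "x + y - (x' + y') = adele_of_rat (r + s)"
    by (simp only: adele_of_rat_add add_diff_add)
  thus "\<exists>r. x + y - (x' + y') = adele_of_rat r" ..
qed

lift_definition uminus_adele_class :: "adele_class \<Rightarrow> adele_class" is uminus
proof -
  fix x x' :: adele
  assume "\<exists>r. x - x' = adele_of_rat r"
  then obtain r where "x - x' = adele_of_rat r" ..
  hence "- x - - x' = adele_of_rat (- r)"
    by (simp only: adele_of_rat_minus minus_diff_minus)
  thus "\<exists>r. - x - - x' = adele_of_rat r" ..
qed

lift_definition minus_adele_class :: "adele_class \<Rightarrow> adele_class \<Rightarrow> adele_class" is "(-)"
proof -
  fix x x' y y' :: adele
  assume "\<exists>r. x - x' = adele_of_rat r" "\<exists>r. y - y' = adele_of_rat r"
  then obtain r s where "x - x' = adele_of_rat r" "y - y' = adele_of_rat s" by blast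
  moreover have "x - y - (x' - y') = (x - x') - (y - y')" by (simp add: algebra_simps)
  ultimately have "x - y - (x' - y') = adele_of_rat (r - s)"
    by (simp only: adele_of_rat_diff)
  thus "\<exists>r. x - y - (x' - y') = adele_of_rat r" ..
qed

instance
proof
  fix x y z :: adele_class
  show "x + y + z = x + (y + z)"
    by transfer (rule exI[of _ 0], simp add: adele_of_rat_0 add.assoc)
  show "x + y = y + x"
    by transfer (rule exI[of _ 0], simp add: adele_of_rat_0 add.commute)
  show "0 + x = x"
    by transfer (rule exI[of _ 0], simp add: adele_of_rat_0)
  show "- x + x = 0"
    by transfer (rule exI[of _ 0], simp add: adele_of_rat_0)
  show "x - y = x + (- y)"
    by transfer (rule exI[of _ 0], simp add: adele_of_rat_0)
qed

end

lift_definition adele_class_scale :: "rat \<Rightarrow> adele_class \<Rightarrow> adele_class" is adele_scale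
proof -
  fix c and x x' :: adele
  assume "\<exists>r. x - x' = adele_of_rat r"
  then obtain r where "x - x' = adele_of_rat r" ..
  hence "adele_scale c x - adele_scale c x' = adele_of_rat (c * r)"
    by (simp only: adele_scale_diff[symmetric] adele_scale_of_rat)
  thus "\<exists>r. adele_scale c x - adele_scale c x' = adele_of_rat r" ..
qed

text \<open>The immersion of a leaf, \<open>t\<close> being sent to the class of the adele with zero finite components.\<close>

lift_definition leaf :: "real \<Rightarrow> adele_class" is adele_of_real .

instantiation adele_class :: topological_space
begin

definition open_adele_class :: "adele_class set \<Rightarrow> bool" where
  "open_adele_class S \<longleftrightarrow> open (abs_adele_class -` S)"

instance
proof
  show "open (UNIV :: adele_class set)" by (simp add: open_adele_class_def)
next
  fix S T :: "adele_class set" assume "open S" "open T"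
  thus "open (S \<inter> T)" unfolding open_adele_class_def vimage_Int by (rule open_Int)
next
  fix K :: "adele_class set set" assume "\<forall>S\<in>K. open S"
  thus "open (\<Union> K)" unfolding open_adele_class_def vimage_Union by (intro open_UN)
qed

end

lemma abs_adele_class_eq: "abs_adele_class x = abs_adele_class y \<longleftrightarrow> (\<exists>r. x - y = adele_of_rat r)"
  by (simp add: adele_class.abs_eq_iff)

lemma leaf_dense:
  assumes "open S" "S \<noteq> {}"
  obtains t where "leaf t \<in> S"
proof -
  obtain X where X: "X \<in> S" using assms(2) by blast
  obtain x where x: "X = abs_adele_class x" 
    using adele_class.abs_induct[of "\<lambda>X. \<exists>x. X = abs_adele_class x" X] by blast
  obtain F e where F: "finite F" "e > 0" and sub: "adele_nbhd F e x \<subseteq> abs_adele_class -` S"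
    using assms(1) X unfolding open_adele_class_def open_adele_def x by blast
  obtain k where k: "(1/2 :: real) ^ k < e" using real_arch_pow_inv[OF F(2), of "1/2"] by auto
  define N where "N = (\<Prod>l\<in>{l\<in>F. prime l}. int l ^ k)"
  have finF: "finite {l\<in>F. prime l}" using F(1) by simp
  have N0: "N \<noteq> 0" unfolding N_def using finF by (auto simp: prime_gt_0_nat)
  have small: "padic_abs l (of_int N) < e" if l: "l \<in> F" "prime l" for l
  proof -
    have "int l ^ k dvd N" unfolding N_def using finF l by (intro dvd_prodI) auto
    hence "padic_abs l (of_int N) \<le> real l powi (- int k)"
      by (simp add: padic_abs_of_int_le_iff[OF l(2) N0])
    also have "\<dots> = inverse (real l) ^ k"
      by (simp add: power_int_minus power_inverse)
    also have "\<dots> \<le> (1/2) ^ k"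
      using prime_ge_2_nat[OF l(2)] by (intro power_mono) (auto simp: field_simps)
    finally show ?thesis using k by linarith
  qed
  obtain s where s: "\<And>l. prime l \<Longrightarrow> adele_abs l (x - adele_of_rat s) \<le> padic_abs l (of_int N)"
    using adele_strong_approx[OF N0] by blast
  define t where "t = adele_real x - of_rat s"
  define z where "z = adele_of_real t + adele_of_rat s"
  have zx: "adele_abs l (z - x) \<le> padic_abs l (of_int N)" if l: "prime l" for l
  proof (rule adele_abs_diff_le[where y = "adele_of_rat s"])
    show "adele_abs l (z - adele_of_rat s) \<le> padic_abs l (of_int N)"
      by (simp add: z_def adele_abs_of_real)
    show "adele_abs l (adele_of_rat s - x) \<le> padic_abs l (of_int N)"
      using s[OF l] by (simp add: adele_abs_diff_commute)
  qed
  have "z \<in> adele_nbhd F e x"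
    unfolding adele_nbhd_def
  proof (intro CollectI conjI allI ballI impI)
    fix l :: nat assume l: "prime l"
    show "adele_abs l (z - x) \<le> 1"
      using zx[OF l] padic_abs_of_int_le_1[OF l] order_trans by blast
  next
    fix l assume l: "l \<in> F" "prime l"
    show "adele_abs l (z - x) < e"
      using zx[OF l(2)] small[OF l] by linarith
  next
    show "\<bar>adele_real z - adele_real x\<bar> < e"
      using F(2) by (simp add: z_def t_def adele_real_add adele_real_of_real adele_real_of_rat)
  qed
  hence "abs_adele_class z \<in> S" using sub by blast
  moreover have "abs_adele_class z = leaf t"
    unfolding leaf.abs_eq abs_adele_class_eq by (intro exI[of _ s]) (simp add: z_def)
  ultimately show thesis using that by metis
qed

text \<open>The unitary character of the adele class group restricting to \<open>t \<mapsto> exp (2 \<pi> i q t)\<close> on the leaf.\<close>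

definition is_adele_class_char :: "rat \<Rightarrow> (adele_class \<Rightarrow> complex) \<Rightarrow> bool" where
  "is_adele_class_char q h \<longleftrightarrow> continuous_on UNIV h \<and> (\<forall>x. norm (h x) = 1) \<and>
     (\<forall>x y. h (x + y) = h x * h y) \<and> (\<forall>t. h (leaf t) = cis (2 * pi * of_rat q * t))"

definition adele_class_char :: "rat \<Rightarrow> adele_class \<Rightarrow> complex" where
  "adele_class_char q = (THE h. is_adele_class_char q h)"

lemma is_adele_class_char_unique:
  assumes "is_adele_class_char q h" "is_adele_class_char q k"
  shows "h = k"
proof (rule ccontr)
  assume "h \<noteq> k"
  hence "{x. h x \<noteq> k x} \<noteq> {}" by auto
  moreover have "open {x. h x \<noteq> k x}"
    using assms by (intro open_Collect_neq) (auto simp: is_adele_class_char_def)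
  ultimately obtain t where "leaf t \<in> {x. h x \<noteq> k x}" by (metis leaf_dense)
  thus False using assms by (simp add: is_adele_class_char_def)
qed

lemma is_adele_class_char_exists: "\<exists>h. is_adele_class_char q h"
proof -
  obtain c N where q: "q = of_int c / of_int N" "N > 0" by (rule rat_fraction_cases)
  have N0: "N \<noteq> 0" using q by simp
  define good where "good x s \<longleftrightarrow>
    (\<forall>l. prime l \<longrightarrow> adele_abs l (x - adele_of_rat s) \<le> padic_abs l (of_int N))" for x s
  have good_ex: "\<exists>s. good x s" for x
  proof -
    obtain s where "\<And>l. prime l \<Longrightarrow> adele_abs l (x - adele_of_rat s) \<le> padic_abs l (of_int N)"
      using adele_strong_approx[OF N0, of x] by metis
    hence "good x s" by (simp add: good_def)
    thus ?thesis ..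
  qed
  define G where "G r s = cis (2 * pi * of_rat q * (r - of_rat s))" for r s
  define g where "g x = G (adele_real x) (SOME s. good x s)" for x
  have G_eq: "G r s = G r t" if st: "good x s" "good x t" for r s t x
  proof -
    have "padic_abs l ((s - t) / of_int N) \<le> 1" if l: "prime l" for l
    proof -
      have "adele_abs l (adele_of_rat s - adele_of_rat t) \<le> padic_abs l (of_int N)"
      proof (rule adele_abs_diff_le)
        show "adele_abs l (adele_of_rat s - x) \<le> padic_abs l (of_int N)"
          using st(1) l unfolding good_def by (metis adele_abs_diff_commute)
        show "adele_abs l (x - adele_of_rat t) \<le> padic_abs l (of_int N)"
          using st(2) l unfolding good_def by blast
      qed
      hence "padic_abs l (s - t) \<le> padic_abs l (of_int N)"
        by (simp add: adele_of_rat_diff[symmetric] adele_abs_of_rat[OF l])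
      thus ?thesis using N0 by (simp add: padic_abs_divide'[OF l] divide_le_eq_1 less_le)
    qed
    hence "(s - t) / of_int N \<in> \<int>" by (rule padic_abs_le_1_imp_Ints)
    then obtain k where k: "(s - t) / of_int N = of_int k" by (elim Ints_cases)
    have "q * (s - t) = of_int c * ((s - t) / of_int N)" unfolding q(1) by simp
    hence "q * (s - t) = of_int (c * k)" unfolding k of_int_mult .
    hence "of_rat q * (of_rat s - of_rat t) = real_of_int (c * k)"
      by (metis of_rat_diff of_rat_mult of_rat_of_int_eq)
    hence k': "2 * pi * (of_rat q * (of_rat s - of_rat t)) = 2 * pi * real_of_int (c * k)" by (simp only:)
    have *: "2 * pi * Q * (r - T) = 2 * pi * Q * (r - S) + 2 * pi * (Q * (S - T))" for Q S T :: real
      by (simp add: algebra_simps)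
    have "G r t = G r s * cis (2 * pi * real_of_int (c * k))"
      unfolding G_def *[of "of_rat q" "of_rat t" "of_rat s"] k' cis_mult ..
    also have "cis (2 * pi * real_of_int (c * k)) = 1" by (rule cis_multiple_2pi) simp
    finally show ?thesis by simp
  qed
  have g: "g x = G (adele_real x) s" if "good x s" for x s
    unfolding g_def by (rule G_eq[OF someI[of "good x", OF that] that])
  have g_add: "g (x + y) = g x * g y" for x y
  proof -
    obtain s t where st: "good x s" "good y t" using good_ex by blast
    have "good (x + y) (s + t)" unfolding good_def
    proof (intro allI impI)
      fix l :: nat assume l: "prime l"
      have "adele_abs l ((x - adele_of_rat s) + (y - adele_of_rat t)) \<le> padic_abs l (of_int N)"
      proof -
        have "adele_abs l (x - adele_of_rat s) \<le> padic_abs l (of_int N)"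
          "adele_abs l (y - adele_of_rat t) \<le> padic_abs l (of_int N)"
          using st l by (auto simp: good_def)
        thus ?thesis
          using adele_abs_add[of l "x - adele_of_rat s" "y - adele_of_rat t"] by linarith
      qed
      thus "adele_abs l (x + y - adele_of_rat (s + t)) \<le> padic_abs l (of_int N)"
        by (simp only: adele_of_rat_add add_diff_add)
    qed
    hence "g (x + y) = G (adele_real (x + y)) (s + t)" by (rule g)
    also have "\<dots> = G (adele_real x) s * G (adele_real y) t"
    proof -
      have *: "2 * pi * Q * (a + b - (S + T)) = 2 * pi * Q * (a - S) + 2 * pi * Q * (b - T)"
        for Q S T a b :: real by (simp add: algebra_simps)
      show ?thesis unfolding G_def adele_real_add of_rat_add cis_mult * ..
    qed
    finally show ?thesis unfolding g[OF st(1)] g[OF st(2)] .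
  qed
  have g_rat: "g (adele_of_rat r) = 1" for r
  proof -
    have "good (adele_of_rat r) r"
      using adele_abs_of_rat[of _ 0] by (simp add: good_def adele_of_rat_0)
    from g[OF this] show ?thesis by (simp add: G_def adele_real_of_rat)
  qed
  have g_real: "g (adele_of_real t) = cis (2 * pi * of_rat q * t)" for t
  proof -
    have "good (adele_of_real t) 0"
      by (simp add: good_def adele_of_rat_0 adele_abs_of_real)
    from g[OF this] show ?thesis by (simp add: G_def adele_real_of_real)
  qed
  have g_cong: "g x = g y" if xy: "abs_adele_class x = abs_adele_class y" for x y
  proof -
    obtain r where "x - y = adele_of_rat r" using xy unfolding abs_adele_class_eq by blast
    hence "x = y + adele_of_rat r" by (metis add.commute diff_add_cancel)
    thus ?thesis by (simp add: g_add g_rat)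
  qed
  have g_open: "open (g -` B)" if B: "open B" for B
    unfolding open_adele_def
  proof
    fix x assume x: "x \<in> g -` B"
    obtain s where s: "good x s" using good_ex by blast
    have gx: "G (adele_real x) s \<in> B" using x g[OF s] by simp
    have "continuous_on UNIV (\<lambda>r. G r s)" unfolding G_def by (intro continuous_intros)
    hence "open ((\<lambda>r. G r s) -` B)" using B by (simp add: open_vimage)
    then obtain e where e: "e > 0" "ball (adele_real x) e \<subseteq> (\<lambda>r. G r s) -` B"
      using gx by (metis open_contains_ball vimageI)
    define F where "F = {l. prime l \<and> int l dvd N}"
    have "F \<subseteq> {..nat \<bar>N\<bar>}" using N0 by (auto simp: F_def dest!: dvd_imp_le_int)
    hence F: "finite F" by (rule finite_subset) simp
    define d where "d = Min (insert e ((\<lambda>l. padic_abs l (of_int N)) ` F))"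
    have pos: "padic_abs l (of_int N) > 0" if "prime l" for l
      using N0 padic_abs_eq_0_iff[OF that, of "of_int N"] padic_abs_nonneg[of l "of_int N"]
      by (metis of_int_eq_0_iff order_le_less)
    have d: "d > 0" unfolding d_def using F e(1) pos by (auto simp: F_def)
    have dF: "d \<le> padic_abs l (of_int N)" if "l \<in> F" for l
      unfolding d_def using F that by (intro Min_le) auto
    have de: "d \<le> e" unfolding d_def using F by (intro Min_le) auto
    have "adele_nbhd F d x \<subseteq> g -` B"
    proof
      fix z assume z: "z \<in> adele_nbhd F d x"
      have zx: "adele_abs l (z - x) \<le> padic_abs l (of_int N)" if l: "prime l" for l
      proof (cases "l \<in> F")
        case True
        hence "adele_abs l (z - x) < d" using z l by (simp add: adele_nbhd_def)
        with dF[OF True] show ?thesis by linarith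
      next
        case False
        hence "padic_abs l (of_int N) = 1" using l padic_abs_of_int_unit by (simp add: F_def)
        thus ?thesis using z l by (simp add: adele_nbhd_def)
      qed
      have "good z s" unfolding good_def
      proof (intro allI impI)
        fix l :: nat assume l: "prime l"
        have "adele_abs l (x - adele_of_rat s) \<le> padic_abs l (of_int N)"
          using s l by (simp add: good_def)
        with zx[OF l] show "adele_abs l (z - adele_of_rat s) \<le> padic_abs l (of_int N)"
          by (rule adele_abs_diff_le)
      qed
      moreover have "adele_real z \<in> ball (adele_real x) e"
        using z de by (auto simp: adele_nbhd_def dist_real_def)
      ultimately show "z \<in> g -` B" using e(2) g[of z s] by auto
    qed
    with F d show "\<exists>F e. finite F \<and> e > 0 \<and> adele_nbhd F e x \<subseteq> g -` B" by blast
  qed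
  define h where "h X = g (rep_adele_class X)" for X
  have h: "h (abs_adele_class x) = g x" for x
    unfolding h_def by (rule g_cong) (rule Quotient3_abs_rep[OF Quotient3_adele_class])
  have "is_adele_class_char q h" unfolding is_adele_class_char_def
  proof (intro conjI allI)
    show "continuous_on UNIV h"
    proof (subst continuous_on_open_vimage[OF open_UNIV], intro allI impI)
      fix B :: "complex set" assume "open B"
      moreover have "abs_adele_class -` (h -` B) = g -` B" by (auto simp: h)
      ultimately show "open (h -` B \<inter> UNIV)" using g_open by (simp add: open_adele_class_def)
    qed
    show "norm (h x) = 1" for x by (simp add: h_def g_def G_def)
    show "h (x + y) = h x * h y" for x y
      by (induction x rule: adele_class.abs_induct, induction y rule: adele_class.abs_induct)
        (simp add: h g_add plus_adele_class.abs_eq)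
    show "h (leaf t) = cis (2 * pi * of_rat q * t)" for t
      by (simp add: leaf.abs_eq h g_real)
  qed
  thus "\<exists>h. is_adele_class_char q h" by (intro exI[of _ h])
qed

lemma adele_class_char: "is_adele_class_char q (adele_class_char q)"
proof -
  obtain h where h: "is_adele_class_char q h" using is_adele_class_char_exists by blast
  have "adele_class_char q = h"
    unfolding adele_class_char_def
    by (rule the_equality[of "is_adele_class_char q" h, OF h])
      (rule is_adele_class_char_unique[OF _ h])
  with h show ?thesis by simp
qed

section \<open>The foliated space and its algebra of functions\<close>

text \<open>
  Points are orbits of the group \<open>{(x, y) \<mapsto> (p\<^sup>n x, p\<^sup>n y) | n \<in> \<int>}\<close> on \<open>G \<times> \<real>\<^sub>+\<close>; multiplication by
  \<open>p\<close> is invertible on \<open>G\<close>, which is a rational vector space.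
\<close>

definition gamma_rel :: "nat \<Rightarrow> ((adele_class \<times> real) \<times> (adele_class \<times> real)) set" where
  "gamma_rel p = {((x, y), (x', y')). y > 0 \<and>
     (\<exists>n::int. x' = adele_class_scale (of_nat p powi n) x \<and> y' = of_nat p powi n * y)}"

definition Gamma :: "nat \<Rightarrow> (adele_class \<times> real) set set" where
  "Gamma p = (UNIV \<times> {0<..}) // gamma_rel p"

definition circle_rel :: "nat \<Rightarrow> (real \<times> real) set" where
  "circle_rel p = {(y, y'). y > 0 \<and> (\<exists>n::int. y' = of_nat p powi n * y)}"

definition circle :: "nat \<Rightarrow> real set set" where
  "circle p = {0<..} // circle_rel p"

text \<open>The image of an orbit in \<open>G \<times> \<real>\<^sub>+\<close> under the second projection is an orbit in \<open>\<real>\<^sub>+\<close>.\<close>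

definition Gamma_proj :: "(adele_class \<times> real) set \<Rightarrow> real set" where
  "Gamma_proj c = snd ` c"

definition smooth_on_pos :: "(real \<Rightarrow> complex) \<Rightarrow> bool" where
  "smooth_on_pos f \<longleftrightarrow>
     (\<forall>n. \<forall>y>0. ((\<lambda>g x. vector_derivative g (at x)) ^^ n) f differentiable (at y))"

text \<open>
  The coefficient functions. The values at \<open>y \<le> 0\<close> carry no information; they are set to \<open>0\<close>
  so that a coefficient function is determined by its restriction to \<open>y > 0\<close>.
\<close>

definition coeff_algebra :: "nat \<Rightarrow> (real \<Rightarrow> rat \<Rightarrow> complex) set" where
  "coeff_algebra p = {f. (\<forall>q. smooth_on_pos (\<lambda>y. f y q)) \<and>
     (\<forall>y>0. \<forall>q. f (of_nat p * y) (q / of_nat p) = f y q) \<and>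
     (\<forall>K. compact K \<and> K \<subseteq> {0<..} \<longrightarrow> (\<exists>Q. finite Q \<and> (\<forall>y\<in>K. \<forall>q. q \<notin> Q \<longrightarrow> f y q = 0))) \<and>
     (\<forall>y\<le>0. \<forall>q. f y q = 0)}"

definition fourier :: "(real \<Rightarrow> rat \<Rightarrow> complex) \<Rightarrow> adele_class \<times> real \<Rightarrow> complex" where
  "fourier f = (\<lambda>(x, y). \<Sum>q | f y q \<noteq> 0. f y q * adele_class_char q x)"

type_synonym gamma_fn = "(adele_class \<times> real) set \<Rightarrow> complex"

text \<open>
  For \<open>f\<close> in \<^term>\<open>coeff_algebra p\<close> the Fourier sum is constant on orbits, and \<open>the_elem\<close> extracts
  its value. Functions on \<^term>\<open>Gamma p\<close> are extended by \<open>0\<close> to the ambient type.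
\<close>

definition gamma_fun :: "nat \<Rightarrow> (real \<Rightarrow> rat \<Rightarrow> complex) \<Rightarrow> gamma_fn" where
  "gamma_fun p f = (\<lambda>c. if c \<in> Gamma p then the_elem (fourier f ` c) else 0)"

definition gamma_algebra :: "nat \<Rightarrow> gamma_fn set" where
  "gamma_algebra p = gamma_fun p ` coeff_algebra p"

text \<open>Distinct coefficient functions give distinct functions on \<^term>\<open>Gamma p\<close>, so this is their inverse.\<close>

definition coeff_of :: "nat \<Rightarrow> gamma_fn \<Rightarrow> real \<Rightarrow> rat \<Rightarrow> complex" where
  "coeff_of p = inv_into (coeff_algebra p) (gamma_fun p)"

definition deriv_X :: "nat \<Rightarrow> gamma_fn \<Rightarrow> gamma_fn" where
  "deriv_X p \<phi> = gamma_fun p (\<lambda>y q. 2 * complex_of_real pi * \<i> * complex_of_real y * of_rat q * coeff_of p \<phi> y q)"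

definition deriv_Y :: "nat \<Rightarrow> gamma_fn \<Rightarrow> gamma_fn" where
  "deriv_Y p \<phi> = gamma_fun p (\<lambda>y q. complex_of_real y * vector_derivative (\<lambda>s. coeff_of p \<phi> s q) (at y))"

section \<open>The leafwise de Rham complex\<close>

text \<open>
  The pair \<open>(f, g)\<close> stands for the leafwise 1-form \<open>f \<alpha> + g \<beta>\<close>, and a leafwise 2-form is given by its
  coefficient with respect to \<open>\<alpha> \<and> \<beta>\<close>. Addition and multiplication of functions are pointwise.
\<close>

definition wedge :: "gamma_fn \<times> gamma_fn \<Rightarrow> gamma_fn \<times> gamma_fn \<Rightarrow> gamma_fn" where
  "wedge \<omega> \<eta> = fst \<omega> * snd \<eta> - snd \<omega> * fst \<eta>"

definition form_alpha :: "gamma_fn \<times> gamma_fn" where "form_alpha = (1, 0)"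

definition form_beta :: "gamma_fn \<times> gamma_fn" where "form_beta = (0, 1)"

definition d_alpha :: gamma_fn where "d_alpha = wedge form_alpha form_beta"

definition leaf_d0 :: "nat \<Rightarrow> gamma_fn \<Rightarrow> gamma_fn \<times> gamma_fn" where
  "leaf_d0 p f = (deriv_X p f, deriv_Y p f)"

definition leaf_d1 :: "nat \<Rightarrow> gamma_fn \<times> gamma_fn \<Rightarrow> gamma_fn" where
  "leaf_d1 p = (\<lambda>(f, g). wedge (leaf_d0 p f) form_alpha + f * d_alpha + wedge (leaf_d0 p g) form_beta)"

definition leaf_forms0 :: "nat \<Rightarrow> gamma_fn set" where
  "leaf_forms0 p = gamma_algebra p"

definition leaf_forms1 :: "nat \<Rightarrow> (gamma_fn \<times> gamma_fn) set" where
  "leaf_forms1 p = gamma_algebra p \<times> gamma_algebra p"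

definition leaf_forms2 :: "nat \<Rightarrow> gamma_fn set" where
  "leaf_forms2 p = gamma_algebra p"

section \<open>The de Rham complex of the base and the pull-back\<close>

definition circle_smooth :: "nat \<Rightarrow> (real set \<Rightarrow> complex) set" where
  "circle_smooth p = {h. (\<forall>c. c \<notin> circle p \<longrightarrow> h c = 0) \<and> smooth_on_pos (\<lambda>y. h (circle_rel p `` {y}))}"

text \<open>The 1-form \<open>h \<beta>\<close> on the base is represented by \<open>h\<close>; \<open>y \<partial>\<^sub>y\<close> is invariant under scaling.\<close>

definition circle_d :: "nat \<Rightarrow> (real set \<Rightarrow> complex) \<Rightarrow> real set \<Rightarrow> complex" where
  "circle_d p h = (\<lambda>c. if c \<in> circle p
     then the_elem ((\<lambda>y. complex_of_real y * vector_derivative (\<lambda>s. h (circle_rel p `` {s})) (at y)) ` c) else 0)"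

definition pullback0 :: "nat \<Rightarrow> (real set \<Rightarrow> complex) \<Rightarrow> gamma_fn" where
  "pullback0 p h = (\<lambda>c. if c \<in> Gamma p then h (Gamma_proj c) else 0)"

definition pullback1 :: "nat \<Rightarrow> (real set \<Rightarrow> complex) \<Rightarrow> gamma_fn \<times> gamma_fn" where
  "pullback1 p h = (0, pullback0 p h)"

text \<open>The base is one-dimensional, so its space of 2-forms is zero.\<close>

definition circle_forms2 :: "(real set \<Rightarrow> complex) set" where
  "circle_forms2 = {0}"

definition pullback2 :: "(real set \<Rightarrow> complex) \<Rightarrow> gamma_fn" where
  "pullback2 \<omega> = 0"

section \<open>Cohomology\<close>

definition scale_fn :: "complex \<Rightarrow> ('s \<Rightarrow> complex) \<Rightarrow> 's \<Rightarrow> complex" where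
  "scale_fn a f = (\<lambda>x. a * f x)"

definition scale_pair :: "complex \<Rightarrow> ('s \<Rightarrow> complex) \<times> ('s \<Rightarrow> complex) \<Rightarrow> ('s \<Rightarrow> complex) \<times> ('s \<Rightarrow> complex)" where
  "scale_pair a = map_prod (scale_fn a) (scale_fn a)"

text \<open>\<open>Z\<close> and \<open>B\<close> are the cocycles and the coboundaries in a fixed degree.\<close>

definition cohomologous :: "'a::ab_group_add set \<Rightarrow> 'a set \<Rightarrow> ('a \<times> 'a) set" where
  "cohomologous Z B = {(u, v). u \<in> Z \<and> v \<in> Z \<and> u - v \<in> B}"

definition cohomology :: "'a::ab_group_add set \<Rightarrow> 'a set \<Rightarrow> 'a set set" where
  "cohomology Z B = Z // cohomologous Z B"

definition induced_map ::
    "('a::ab_group_add \<Rightarrow> 'b::ab_group_add) \<Rightarrow> 'b set \<Rightarrow> 'b set \<Rightarrow> 'a set \<Rightarrow> 'b set" where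
  "induced_map F Z' B' C = cohomologous Z' B' `` (F ` C)"

text \<open>Linearity of \<open>F\<close> on cocycles makes the induced map linear.\<close>

definition cohomology_iso ::
    "(complex \<Rightarrow> 'a \<Rightarrow> 'a) \<Rightarrow> (complex \<Rightarrow> 'b \<Rightarrow> 'b) \<Rightarrow> ('a::ab_group_add \<Rightarrow> 'b::ab_group_add) \<Rightarrow>
     'a set \<Rightarrow> 'a set \<Rightarrow> 'b set \<Rightarrow> 'b set \<Rightarrow> bool" where
  "cohomology_iso s s' F Z B Z' B' \<longleftrightarrow>
     (\<forall>u\<in>Z. \<forall>v\<in>Z. F (u + v) = F u + F v) \<and> (\<forall>a. \<forall>u\<in>Z. F (s a u) = s' a (F u)) \<and>
     F ` Z \<subseteq> Z' \<and> F ` B \<subseteq> B' \<and>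
     bij_betw (induced_map F Z' B') (cohomology Z B) (cohomology Z' B')"

end

theory Submission
  imports Defs
begin

text \<open>
  Write a function on \<open>\<Gamma>(p)\<close> through its Fourier coefficients \<open>f(y, q)\<close>. The characters \<open>e\<^sub>q\<close> are linearly
  independent, so a function determines its coefficients (\<open>gamma_fun_inj\<close>), and the leafwise complex
  becomes a complex of coefficient functions, with \<open>X\<close> the multiplication by \<open>2 \<pi> \<i> y q\<close>,
  \<open>Y = y \<partial>\<^sub>y\<close>, and \<open>d (f \<alpha> + g \<beta>) = (f - Y f + X g) \<alpha> \<and> \<beta>\<close>. The pull-back identifies functions on the base with the
  coefficient functions concentrated in \<open>q = 0\<close>.

  The complex splits according to whether \<open>q\<close> is zero. On the modes \<open>q \<noteq> 0\<close> the operator \<open>X\<close> is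
  invertible (\<open>coeff_X_div_X\<close>), and dividing by it is a contracting homotopy: invariant functions
  have no such modes, the \<open>\<alpha>\<close>-component \<open>f\<close> of a closed form is \<open>X k\<close>, with \<open>Y k = g\<close> as a consequence of closedness,
  and every 2-form is \<open>X g\<close>. On the mode \<open>q = 0\<close> the operator \<open>X\<close> vanishes and the complex is the de Rham
  complex of the circle in the direction \<open>\<beta>\<close> plus the two-term complex \<open>f \<mapsto> f - Y f\<close> from the \<open>\<alpha>\<close>-component to
  the 2-forms. The latter is acyclic on functions that are invariant under \<open>y \<mapsto> p y\<close>: the solutions of \<open>f = y f'\<close>
  are the multiples of \<open>y\<close>, none of which is invariant except \<open>0\<close> (\<open>periodic_euler_homogeneous\<close>), and the same
  multiples of \<open>y\<close> serve to correct a solution of \<open>f - y f' = u\<close> to an invariant one (\<open>periodic_euler_solvable\<close>).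
  So only the de Rham complex of the circle contributes to cohomology.
\<close>

section \<open>Induced maps in cohomology\<close>

definition is_subgroup :: "'a::ab_group_add set \<Rightarrow> bool" where
  "is_subgroup A \<longleftrightarrow> 0 \<in> A \<and> (\<forall>u\<in>A. \<forall>v\<in>A. u - v \<in> A)"

lemma is_subgroup_image:
  fixes F :: "'a::ab_group_add \<Rightarrow> 'b::ab_group_add"
  assumes A: "is_subgroup A" and F: "\<And>u v. u \<in> A \<Longrightarrow> v \<in> A \<Longrightarrow> F (u - v) = F u - F v"
  shows "is_subgroup (F ` A)"
proof -
  have "F 0 = 0" using F[of 0 0] A by (simp add: is_subgroup_def)
  with A show ?thesis unfolding is_subgroup_def by (auto simp flip: F)
qed

lemma is_subgroup_kernel:
  fixes F :: "'a::ab_group_add \<Rightarrow> 'b::ab_group_add"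
  assumes A: "is_subgroup A" and F: "\<And>u v. u \<in> A \<Longrightarrow> v \<in> A \<Longrightarrow> F (u - v) = F u - F v"
  shows "is_subgroup {u \<in> A. F u = 0}"
proof -
  have "F 0 = 0" using F[of 0 0] A by (simp add: is_subgroup_def)
  with A show ?thesis by (simp add: is_subgroup_def F)
qed

lemma equiv_cohomologous:
  assumes "is_subgroup Z" "is_subgroup B"
  shows "equiv Z (cohomologous Z B)"
proof (rule equivI)
  have add: "u + v \<in> B" if "u \<in> B" "v \<in> B" for u v
    using assms(2) that unfolding is_subgroup_def by (metis diff_0 diff_minus_eq_add)
  show "refl_on Z (cohomologous Z B)"
    using assms by (auto simp: refl_on_def cohomologous_def is_subgroup_def)
  show "sym (cohomologous Z B)"
    using assms(2) unfolding sym_def cohomologous_def is_subgroup_def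
    by (auto dest: bspec) (metis diff_0 minus_diff_eq)
  show "trans (cohomologous Z B)"
    unfolding trans_def cohomologous_def using add by (auto, metis diff_add_cancel diff_diff_eq2 add_diff_eq)
qed (auto simp: cohomologous_def)

text \<open>
  This turns a statement about quotient sets into two statements about representatives: only
  coboundaries become exact, and every cocycle of the target is a pulled back cocycle up to a
  coboundary.
\<close>

lemma cohomology_isoI:
  assumes Z: "is_subgroup Z" and B: "is_subgroup B"
    and Z': "is_subgroup Z'" and B': "is_subgroup B'"
    and add: "\<And>u v. u \<in> Z \<Longrightarrow> v \<in> Z \<Longrightarrow> F (u + v) = F u + F v"
    and scale: "\<And>a u. u \<in> Z \<Longrightarrow> F (s a u) = s' a (F u)"
    and FZ: "F ` Z \<subseteq> Z'" and FB: "F ` B \<subseteq> B'"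
    and inj: "\<And>u. u \<in> Z \<Longrightarrow> F u \<in> B' \<Longrightarrow> u \<in> B"
    and surj: "\<And>w. w \<in> Z' \<Longrightarrow> \<exists>u\<in>Z. w - F u \<in> B'"
  shows "cohomology_iso s s' F Z B Z' B'"
proof -
  let ?R = "cohomologous Z B" and ?R' = "cohomologous Z' B'"
  have R: "equiv Z ?R" and R': "equiv Z' ?R'"
    using equiv_cohomologous Z B Z' B' by blast+
  have diff_Z: "u - v \<in> Z" if "u \<in> Z" "v \<in> Z" for u v
    using Z that by (simp add: is_subgroup_def)
  have diff: "F (u - v) = F u - F v" if "u \<in> Z" "v \<in> Z" for u v
    using add[OF diff_Z[OF that] that(2)] by simp
  have class_iff: "(F u, F v) \<in> ?R' \<longleftrightarrow> (u, v) \<in> ?R" if "u \<in> Z" "v \<in> Z" for u v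
    using that FZ FB inj[OF diff_Z[OF that]] diff[OF that] by (auto simp: cohomologous_def)
  have induced: "induced_map F Z' B' (?R `` {u}) = ?R' `` {F u}" if u: "u \<in> Z" for u
  proof -
    have "?R' `` {F v} = ?R' `` {F u}" if "v \<in> ?R `` {u}" for v
    proof -
      have "(u, v) \<in> ?R" "v \<in> Z" using that by (auto simp: cohomologous_def)
      hence "(F u, F v) \<in> ?R'" using class_iff[OF u] by blast
      thus ?thesis using equiv_class_eq[OF R'] by blast
    qed
    moreover have "u \<in> ?R `` {u}" using equiv_class_self[OF R u] .
    ultimately show ?thesis unfolding induced_map_def by blast
  qed
  have "bij_betw (induced_map F Z' B') (cohomology Z B) (cohomology Z' B')"
    unfolding bij_betw_def
  proof
    show "inj_on (induced_map F Z' B') (cohomology Z B)"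
    proof (rule inj_onI)
      fix C D assume C: "C \<in> cohomology Z B" and D: "D \<in> cohomology Z B"
        and eq: "induced_map F Z' B' C = induced_map F Z' B' D"
      obtain u v where u: "u \<in> Z" "C = ?R `` {u}" and v: "v \<in> Z" "D = ?R `` {v}"
        using C D unfolding cohomology_def by (auto elim!: quotientE)
      have "F u \<in> Z'" "F v \<in> Z'" using u v FZ by auto
      hence "(F u, F v) \<in> ?R'"
        using eq u v by (simp add: induced eq_equiv_class_iff[OF R'])
      thus "C = D" using class_iff u v equiv_class_eq[OF R] by blast
    qed
    show "induced_map F Z' B' ` cohomology Z B = cohomology Z' B'"
    proof (intro equalityI subsetI)
      fix C assume "C \<in> induced_map F Z' B' ` cohomology Z B"
      thus "C \<in> cohomology Z' B'"
        using FZ[THEN subsetD, OF imageI] unfolding cohomology_def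
        by (auto elim!: quotientE simp: induced intro!: quotientI)
    next
      fix C assume "C \<in> cohomology Z' B'"
      then obtain w where w: "w \<in> Z'" "C = ?R' `` {w}" unfolding cohomology_def by (rule quotientE)
      obtain u where u: "u \<in> Z" "w - F u \<in> B'" using surj[OF w(1)] by blast
      hence "(w, F u) \<in> ?R'" using w FZ by (auto simp: cohomologous_def)
      hence "C = induced_map F Z' B' (?R `` {u})"
        using w u equiv_class_eq[OF R'] by (simp add: induced)
      moreover have "?R `` {u} \<in> cohomology Z B" unfolding cohomology_def using u by (intro quotientI)
      ultimately show "C \<in> induced_map F Z' B' ` cohomology Z B" by blast
    qed
  qed
  thus ?thesis using add scale FZ FB by (auto simp: cohomology_iso_def)
qed

section \<open>Smooth functions on the half-line\<close>

text \<open>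
  Smoothness in terms of iterated derivative operators does not pass easily to products, because
  the \<open>n\<close>-th iterate is then given by the Leibniz formula. Differentiability up to order \<open>n\<close>, with the
  derivative as an existential witness, is instead preserved by products through a plain induction
  on \<open>n\<close>, as \<open>(f g)' = f g' + f' g\<close> is a sum of products of functions of the lower order.
\<close>

primrec differentiable_order :: "nat \<Rightarrow> (real \<Rightarrow> complex) \<Rightarrow> bool" where
  "differentiable_order 0 f = True"
| "differentiable_order (Suc n) f =
    (\<exists>f'. (\<forall>y>0. (f has_vector_derivative f' y) (at y)) \<and> differentiable_order n f')"

lemma has_vector_derivative_cong_pos:
  fixes f g :: "real \<Rightarrow> complex"
  assumes "y > 0" "\<And>s. s > 0 \<Longrightarrow> f s = g s"
  shows "(f has_vector_derivative D) (at y) \<longleftrightarrow> (g has_vector_derivative D) (at y)"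
proof -
  have "\<forall>\<^sub>F s in nhds y. f s = g s"
    using eventually_nhds_in_open[of "{0<..}" y] assms by (auto elim: eventually_mono)
  thus ?thesis using assms by (intro has_vector_derivative_cong_ev) (auto elim: eventually_mono)
qed

lemma differentiable_order_cong:
  assumes "differentiable_order n f" "\<And>y. y > 0 \<Longrightarrow> f y = g y"
  shows "differentiable_order n g"
proof (cases n)
  case (Suc m)
  then show ?thesis using assms has_vector_derivative_cong_pos[OF _ assms(2)] by simp
qed simp

lemma differentiable_order_funpow:
  assumes "differentiable_order (Suc n) f" "y > 0"
  shows "((\<lambda>g x. vector_derivative g (at x)) ^^ n) f differentiable (at y)"
  using assms
proof (induction n arbitrary: f)
  case 0
  then show ?case by (auto intro: differentiableI_vector)
next
  case (Suc n)
  then obtain f' where f': "\<And>y. y > 0 \<Longrightarrow> (f has_vector_derivative f' y) (at y)"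
    and o: "differentiable_order (Suc n) f'" by auto
  have "differentiable_order (Suc n) (\<lambda>x. vector_derivative f (at x))"
    by (rule differentiable_order_cong[OF o]) (simp add: vector_derivative_at[OF f'])
  from Suc.IH[OF this Suc.prems(2)] show ?case by (simp only: funpow_Suc_right o_apply)
qed

lemma smooth_on_pos_iff_order: "smooth_on_pos f \<longleftrightarrow> (\<forall>n. differentiable_order n f)"
proof (intro iffI allI)
  fix n assume "smooth_on_pos f"
  thus "differentiable_order n f"
  proof (induction n arbitrary: f)
    case (Suc n)
    let ?D = "\<lambda>g x. vector_derivative g (at x) :: complex"
    have "f differentiable (at y)" if "y > 0" for y
      using Suc.prems that unfolding smooth_on_pos_def by (metis funpow_0)
    moreover have "smooth_on_pos (?D f)" unfolding smooth_on_pos_def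
    proof (intro allI impI)
      fix n and y :: real assume "y > 0"
      with Suc.prems have "(?D ^^ (Suc n)) f differentiable (at y)"
        unfolding smooth_on_pos_def by blast
      thus "(?D ^^ n) (?D f) differentiable (at y)" by (simp only: funpow_Suc_right o_apply)
    qed
    ultimately show ?case using Suc.IH[of "?D f"]
      by (auto simp: vector_derivative_works intro!: exI[of _ "?D f"])
  qed simp
next
  assume "\<forall>n. differentiable_order n f"
  thus "smooth_on_pos f" unfolding smooth_on_pos_def using differentiable_order_funpow by blast
qed

lemma smooth_on_pos_cong:
  "smooth_on_pos f \<Longrightarrow> (\<And>y. y > 0 \<Longrightarrow> f y = g y) \<Longrightarrow> smooth_on_pos g"
  unfolding smooth_on_pos_iff_order using differentiable_order_cong by blast

lemma smooth_on_pos_has_vector_derivative: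
  assumes "smooth_on_pos f" "y > 0"
  shows "(f has_vector_derivative vector_derivative f (at y)) (at y)"
  using assms unfolding smooth_on_pos_def vector_derivative_works[symmetric] by (metis funpow_0)

lemma smooth_on_pos_vector_derivative:
  assumes "smooth_on_pos f"
  shows "smooth_on_pos (\<lambda>y. vector_derivative f (at y))"
  unfolding smooth_on_pos_iff_order
proof
  fix n
  have "differentiable_order (Suc n) f" using assms by (simp only: smooth_on_pos_iff_order)
  then obtain f' where f': "\<And>y. y > 0 \<Longrightarrow> (f has_vector_derivative f' y) (at y)"
    and o: "differentiable_order n f'" by auto
  show "differentiable_order n (\<lambda>y. vector_derivative f (at y))"
    by (rule differentiable_order_cong[OF o]) (simp add: vector_derivative_at[OF f'])
qed

text \<open>
  The antiderivative that solves the Euler equation below is smooth for this reason.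
\<close>

lemma smooth_on_pos_antiderivative:
  assumes "smooth_on_pos f'" "\<And>y. y > 0 \<Longrightarrow> (f has_vector_derivative f' y) (at y)"
  shows "smooth_on_pos f"
  unfolding smooth_on_pos_iff_order
proof
  fix n show "differentiable_order n f"
  proof (cases n)
    case (Suc m)
    with assms show ?thesis unfolding smooth_on_pos_iff_order Suc differentiable_order.simps by blast
  qed simp
qed

lemma differentiable_order_Suc_imp: "differentiable_order (Suc n) f \<Longrightarrow> differentiable_order n f"
proof (induction n arbitrary: f)
  case (Suc n)
  then show ?case unfolding differentiable_order.simps(2)[of "Suc n"] differentiable_order.simps(2)[of n]
    by blast
qed simp

lemma differentiable_order_const: "differentiable_order n (\<lambda>y. c)"
proof (induction n arbitrary: c)
  case (Suc n)
  have "\<forall>y>0. ((\<lambda>y. c) has_vector_derivative 0) (at y)" by simp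
  with Suc[of 0] show ?case unfolding differentiable_order.simps by (intro exI conjI)
qed simp

lemma differentiable_order_add:
  "differentiable_order n f \<Longrightarrow> differentiable_order n g \<Longrightarrow> differentiable_order n (\<lambda>y. f y + g y)"
proof (induction n arbitrary: f g)
  case (Suc n)
  from Suc.prems obtain f' g'
    where f': "\<forall>y>0. (f has_vector_derivative f' y) (at y)" "differentiable_order n f'"
      and g': "\<forall>y>0. (g has_vector_derivative g' y) (at y)" "differentiable_order n g'" by auto
  have "\<forall>y>0. ((\<lambda>y. f y + g y) has_vector_derivative f' y + g' y) (at y)"
    using f'(1) g'(1) by (simp add: has_vector_derivative_add)
  with Suc.IH[OF f'(2) g'(2)] show ?case
    unfolding differentiable_order.simps by (intro exI conjI)
qed simp

lemma differentiable_order_mult: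
  "differentiable_order n f \<Longrightarrow> differentiable_order n g \<Longrightarrow> differentiable_order n (\<lambda>y. f y * g y)"
proof (induction n arbitrary: f g)
  case (Suc n)
  from Suc.prems obtain f' g'
    where f': "\<forall>y>0. (f has_vector_derivative f' y) (at y)" "differentiable_order n f'"
      and g': "\<forall>y>0. (g has_vector_derivative g' y) (at y)" "differentiable_order n g'" by auto
  have "differentiable_order n (\<lambda>y. f y * g' y + f' y * g y)"
    using Suc.prems[THEN differentiable_order_Suc_imp] f'(2) g'(2)
    by (intro differentiable_order_add Suc.IH)
  moreover have "\<forall>y>0. ((\<lambda>y. f y * g y) has_vector_derivative f y * g' y + f' y * g y) (at y)"
    using f'(1) g'(1) by (simp add: has_vector_derivative_mult)
  ultimately show ?case unfolding differentiable_order.simps by (intro exI conjI)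
qed simp

lemma smooth_on_pos_const: "smooth_on_pos (\<lambda>y. c)"
  by (simp add: smooth_on_pos_iff_order differentiable_order_const)

lemma smooth_on_pos_mult: "smooth_on_pos f \<Longrightarrow> smooth_on_pos g \<Longrightarrow> smooth_on_pos (\<lambda>y. f y * g y)"
  by (simp add: smooth_on_pos_iff_order differentiable_order_mult)

lemma smooth_on_pos_diff:
  assumes "smooth_on_pos f" "smooth_on_pos g" shows "smooth_on_pos (\<lambda>y. f y - g y)"
  using assms differentiable_order_add[of _ f "\<lambda>y. - 1 * g y"]
    differentiable_order_mult[OF differentiable_order_const, of _ g "- 1"]
  by (simp add: smooth_on_pos_iff_order)

lemma smooth_on_pos_of_real: "smooth_on_pos complex_of_real"
proof (rule smooth_on_pos_antiderivative[OF smooth_on_pos_const[of 1]])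
  fix y :: real
  show "(complex_of_real has_vector_derivative 1) (at y)"
    using has_vector_derivative_of_real[OF DERIV_ident[of "at y"]] by simp
qed

lemma inverse_of_real_has_vector_derivative:
  assumes "y \<noteq> 0"
  shows "((\<lambda>y. inverse (complex_of_real y)) has_vector_derivative
    - (inverse (complex_of_real y) * inverse (complex_of_real y))) (at y)"
proof -
  have "(inverse has_real_derivative - (inverse y * inverse y)) (at y)"
    using DERIV_inverse[OF assms] by (simp add: power2_eq_square)
  from has_vector_derivative_of_real[OF this, where 'a = complex] show ?thesis by simp
qed

lemma smooth_on_pos_inverse: "smooth_on_pos (\<lambda>y. inverse (complex_of_real y))"
  unfolding smooth_on_pos_iff_order
proof
  fix n show "differentiable_order n (\<lambda>y. inverse (complex_of_real y))"
  proof (induction n)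
    case (Suc n)
    let ?i = "\<lambda>y. inverse (complex_of_real y)"
    have "differentiable_order n (\<lambda>y. - 1 * (?i y * ?i y))"
      by (intro differentiable_order_mult differentiable_order_const Suc)
    moreover have "\<forall>y>0. (?i has_vector_derivative - 1 * (?i y * ?i y)) (at y)"
      using inverse_of_real_has_vector_derivative by simp
    ultimately show ?case unfolding differentiable_order.simps by (intro exI conjI)
  qed simp
qed

lemma constant_on_pos:
  fixes f :: "real \<Rightarrow> complex"
  assumes "\<And>y. y > 0 \<Longrightarrow> (f has_vector_derivative 0) (at y)"
  shows "\<exists>c. \<forall>y>0. f y = c"
proof -
  obtain c where "\<And>y. y \<in> {0<..} \<Longrightarrow> f y = c"
    by (rule has_vector_derivative_zero_constant[of "{0<..}" f])
      (auto intro: has_vector_derivative_at_within assms)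
  thus ?thesis by auto
qed

section \<open>Characters of the adele class group\<close>

lemma adele_class_scale_add_left:
  "adele_class_scale (r + s) x = adele_class_scale r x + adele_class_scale s x"
proof -
  have *: "adele_scale (r + s) x = adele_scale r x + adele_scale s x" for r s x
  proof (transfer, goal_cases)
    case (1 r s x)
    hence "raw_adele x" by (simp add: adele_rel_def)
    hence "raw_adele (\<lambda>l n. (r + s) * fst x l n, of_rat (r + s) * snd x)"
      by (rule raw_adele_scale)
    from adele_rel_refl[OF this] show ?case
      by (simp add: distrib_right of_rat_add)
  qed
  show ?thesis by transfer (rule exI[of _ 0], simp add: * adele_of_rat_0)
qed

lemma adele_class_scale_scale: "adele_class_scale r (adele_class_scale s x) = adele_class_scale (r * s) x"
proof -
  have *: "adele_scale r (adele_scale s x) = adele_scale (r * s) x" for r s x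
  proof (transfer, goal_cases)
    case (1 r s x)
    hence "raw_adele x" by (simp add: adele_rel_def)
    hence "raw_adele (\<lambda>l n. (r * s) * fst x l n, of_rat (r * s) * snd x)"
      by (rule raw_adele_scale)
    from adele_rel_refl[OF this] show ?case
      by (simp add: mult.assoc of_rat_mult)
  qed
  show ?thesis by transfer (rule exI[of _ 0], simp add: * adele_of_rat_0)
qed

lemma adele_class_scale_1 [simp]: "adele_class_scale 1 x = x"
proof -
  have *: "adele_scale 1 x = x" for x
    by (transfer) (simp add: adele_rel_def)
  show ?thesis by transfer (rule exI[of _ 0], simp add: * adele_of_rat_0)
qed

lemma adele_class_char_leaf: "adele_class_char q (leaf t) = cis (2 * pi * of_rat q * t)"
  using adele_class_char[of q] by (simp add: is_adele_class_char_def)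

lemma adele_class_char_add: "adele_class_char q (x + y) = adele_class_char q x * adele_class_char q y"
  using adele_class_char[of q] by (simp add: is_adele_class_char_def)

lemma adele_class_char_nonzero: "adele_class_char q x \<noteq> 0"
  using adele_class_char[of q] unfolding is_adele_class_char_def by (metis norm_zero zero_neq_one)

lemma adele_class_char_0_right [simp]: "adele_class_char q 0 = 1"
  using adele_class_char_add[of q 0 0] adele_class_char_nonzero[of q 0] by simp

text \<open>
  Identities between characters follow from uniqueness: the candidate only has to be
  a continuous character with the right restriction to the leaf through \<open>0\<close>.
\<close>

lemma adele_class_char_eqI: "is_adele_class_char q h \<Longrightarrow> adele_class_char q = h"
  using is_adele_class_char_unique[OF adele_class_char] .

lemma adele_class_char_0: "adele_class_char 0 x = 1"
proof -
  have "adele_class_char 0 = (\<lambda>x. 1)"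
    by (rule adele_class_char_eqI) (simp add: is_adele_class_char_def)
  thus ?thesis by simp
qed

lemma adele_class_char_add_left: "adele_class_char (q + r) x = adele_class_char q x * adele_class_char r x"
proof -
  have "adele_class_char (q + r) = (\<lambda>x. adele_class_char q x * adele_class_char r x)"
    using adele_class_char[of q] adele_class_char[of r]
    by (intro adele_class_char_eqI)
      (auto simp: is_adele_class_char_def norm_mult cis_mult of_rat_add algebra_simps
        intro!: continuous_on_mult)
  thus ?thesis by (rule fun_cong)
qed

text \<open>
  Scaling by \<open>m\<close> is the \<open>m\<close>-fold sum, so this follows from additivity of the character in each of
  its two arguments, without continuity of the scaling.
\<close>

lemma adele_class_char_scale_of_nat:
  "adele_class_char q (adele_class_scale (of_nat m) x) = adele_class_char (of_nat m * q) x"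
proof (induction m)
  case 0
  have "adele_class_scale 0 x = 0" using adele_class_scale_add_left[of 0 0 x] by simp
  then show ?case by (simp add: adele_class_char_0)
next
  case (Suc m)
  then show ?case
    by (simp add: adele_class_scale_add_left adele_class_char_add adele_class_char_add_left distrib_right)
qed

lemma adele_class_char_scale_powi:
  assumes "p > 0"
  shows "adele_class_char q (adele_class_scale (of_nat p powi n) x) = adele_class_char (of_nat p powi n * q) x"
proof (cases "n \<ge> 0")
  case True
  then show ?thesis
    using adele_class_char_scale_of_nat[of q "p ^ nat n" x] by (simp add: power_int_def)
next
  case False
  define m where "m = p ^ nat (- n)"
  have m: "(of_nat p :: rat) powi n = 1 / of_nat m" "m > 0"
    using False assms by (auto simp: power_int_def m_def inverse_eq_divide power_one_over)
  \<comment> \<open>a multiple of the character \<open>q / m\<close>, so that the two scalings cancel\<close>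
  have "q = of_nat m * (q / of_nat m)" using m(2) by simp
  hence "adele_class_char q (adele_class_scale (1 / of_nat m) x)
      = adele_class_char (q / of_nat m) (adele_class_scale (of_nat m) (adele_class_scale (1 / of_nat m) x))"
    by (metis adele_class_char_scale_of_nat)
  also have "\<dots> = adele_class_char (q / of_nat m) x"
    using m(2) by (simp add: adele_class_scale_scale)
  finally show ?thesis by (simp add: m)
qed

lemma adele_class_char_inj:
  assumes "\<And>x. adele_class_char q x = adele_class_char r x"
  shows "q = r"
proof (rule ccontr)
  assume "q \<noteq> r"
  hence d: "of_rat (q - r) \<noteq> (0 :: real)" by simp
  \<comment> \<open>at this point of the leaf the character \<open>q - r\<close> takes the value \<open>-1\<close>\<close>
  let ?t = "1 / (2 * of_rat (q - r)) :: real"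
  have "adele_class_char r (leaf ?t) * adele_class_char (q - r) (leaf ?t) = adele_class_char r (leaf ?t)"
    using assms[of "leaf ?t"] adele_class_char_add_left[of r "q - r" "leaf ?t"] by simp
  hence "adele_class_char (q - r) (leaf ?t) = 1" using adele_class_char_nonzero by simp
  moreover have "2 * pi * of_rat (q - r) * ?t = pi" using d by simp
  ultimately show False unfolding adele_class_char_leaf by (simp del: of_rat_diff)
qed

text \<open>
  The Dedekind--Artin argument: if \<open>\<Sum> c\<^sub>q e\<^sub>q = 0\<close>, then translating by \<open>y\<close> and subtracting \<open>e\<^sub>r(y)\<close> times
  the relation gives the shorter relation \<open>\<Sum> c\<^sub>q (e\<^sub>q(y) - e\<^sub>r(y)) e\<^sub>q = 0\<close>, in which \<open>e\<^sub>r\<close> no longer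
  occurs; a \<open>y\<close> that separates \<open>q\<close> from \<open>r\<close> shows \<open>c\<^sub>q = 0\<close>.
\<close>

lemma adele_class_char_independent:
  assumes "finite S" "\<And>x. (\<Sum>q\<in>S. c q * adele_class_char q x) = 0" "q \<in> S"
  shows "c q = 0"
  using assms
proof (induction S arbitrary: c q rule: finite_induct)
  case (insert r S)
  let ?e = adele_class_char
  have other: "c q = 0" if "q \<in> S" for q
  proof -
    have "q \<noteq> r" using that insert.hyps by auto
    then obtain y where y: "?e q y \<noteq> ?e r y" using adele_class_char_inj by blast
    have "(\<Sum>q\<in>S. (c q * (?e q y - ?e r y)) * ?e q x) = 0" for x
    proof -
      have "(\<Sum>q\<in>S. (c q * (?e q y - ?e r y)) * ?e q x)
          = (\<Sum>q\<in>S. c q * ?e q (x + y)) - ?e r y * (\<Sum>q\<in>S. c q * ?e q x)"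
        by (simp add: sum_subtractf sum_distrib_left adele_class_char_add algebra_simps)
      also have "(\<Sum>q\<in>S. c q * ?e q (x + y)) = - (c r * ?e r (x + y))"
        using insert.prems(1)[of "x + y"] insert.hyps by (simp add: eq_neg_iff_add_eq_0 add.commute)
      also have "(\<Sum>q\<in>S. c q * ?e q x) = - (c r * ?e r x)"
        using insert.prems(1)[of x] insert.hyps by (simp add: eq_neg_iff_add_eq_0 add.commute)
      finally show ?thesis by (simp add: adele_class_char_add)
    qed
    from insert.IH[OF this that] y show ?thesis by simp
  qed
  moreover have "c r = 0"
    using insert.prems(1)[of 0] insert.hyps other by simp
  ultimately show ?case using insert.prems(2) by auto
qed simp

section \<open>Operations on coefficient functions\<close>

definition coeff_X :: "(real \<Rightarrow> rat \<Rightarrow> complex) \<Rightarrow> real \<Rightarrow> rat \<Rightarrow> complex" where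
  "coeff_X f = (\<lambda>y q. 2 * complex_of_real pi * \<i> * complex_of_real y * of_rat q * f y q)"

definition coeff_Y :: "(real \<Rightarrow> rat \<Rightarrow> complex) \<Rightarrow> real \<Rightarrow> rat \<Rightarrow> complex" where
  "coeff_Y f = (\<lambda>y q. complex_of_real y * vector_derivative (\<lambda>s. f s q) (at y))"

text \<open>
  The inverse of \<open>X\<close> on the modes \<open>q \<noteq> 0\<close>. Since \<open>inverse 0 = 0\<close>, the mode \<open>q = 0\<close> is sent to \<open>0\<close>.
\<close>

definition coeff_div_X :: "(real \<Rightarrow> rat \<Rightarrow> complex) \<Rightarrow> real \<Rightarrow> rat \<Rightarrow> complex" where
  "coeff_div_X f = (\<lambda>y q. inverse (2 * complex_of_real pi * \<i> * of_rat q) * (inverse (complex_of_real y) * f y q))"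

definition zero_mode :: "(real \<Rightarrow> complex) \<Rightarrow> real \<Rightarrow> rat \<Rightarrow> complex" where
  "zero_mode \<phi> = (\<lambda>y q. if q = 0 \<and> y > 0 then \<phi> y else 0)"

text \<open>
  The coefficients of the pull-back of a function on the base (\<open>pullback0_eq\<close>).
\<close>

definition base_coeff :: "nat \<Rightarrow> (real set \<Rightarrow> complex) \<Rightarrow> real \<Rightarrow> rat \<Rightarrow> complex" where
  "base_coeff p h = zero_mode (\<lambda>y. h (circle_rel p `` {y}))"

text \<open>
  The coefficient at \<open>q = 0\<close> is invariant under \<open>y \<mapsto> p y\<close>, so it is a function on the base.
\<close>

definition circle_fun :: "nat \<Rightarrow> (real \<Rightarrow> rat \<Rightarrow> complex) \<Rightarrow> real set \<Rightarrow> complex" where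
  "circle_fun p f = (\<lambda>c. if c \<in> circle p then the_elem ((\<lambda>y. f y 0) ` c) else 0)"

lemma coeff_Y_cong:
  assumes "y > 0" "\<And>s. s > 0 \<Longrightarrow> f s q = \<phi> s"
  shows "coeff_Y f y q = of_real y * vector_derivative \<phi> (at y)"
  using has_vector_derivative_cong_pos[of y "\<lambda>s. f s q" \<phi>] assms
  by (simp add: coeff_Y_def vector_derivative_def)

context
  fixes p :: nat
  assumes p_gt_1: "p > 1"
begin

section \<open>Orbits\<close>

lemma gamma_class_eq:
  "y > 0 \<Longrightarrow> gamma_rel p `` {(x, y)} =
     range (\<lambda>n::int. (adele_class_scale (of_nat p powi n) x, of_nat p powi n * y))"
  by (auto simp: gamma_rel_def)

lemma gamma_class_in_Gamma: "y > 0 \<Longrightarrow> gamma_rel p `` {(x, y)} \<in> Gamma p"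
  unfolding Gamma_def by (rule quotientI) simp

lemma Gamma_cases:
  assumes "c \<in> Gamma p"
  obtains x y where "y > 0" "c = gamma_rel p `` {(x, y)}"
  using assms unfolding Gamma_def by (auto elim!: quotientE)

lemma circle_class_eq: "y > 0 \<Longrightarrow> circle_rel p `` {y} = range (\<lambda>n::int. of_nat p powi n * y)"
  by (auto simp: circle_rel_def)

lemma circle_class_in_circle: "y > 0 \<Longrightarrow> circle_rel p `` {y} \<in> circle p"
  unfolding circle_def by (rule quotientI) simp

lemma circle_cases:
  assumes "c \<in> circle p"
  obtains y where "y > 0" "c = circle_rel p `` {y}"
  using assms unfolding circle_def by (auto elim!: quotientE)

lemma Gamma_proj_class: "y > 0 \<Longrightarrow> Gamma_proj (gamma_rel p `` {(x, y)}) = circle_rel p `` {y}"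
  by (simp add: Gamma_proj_def gamma_class_eq circle_class_eq image_image)

lemma circle_class_scale:
  assumes "y > 0"
  shows "circle_rel p `` {of_nat p * y} = circle_rel p `` {y}"
proof -
  have "surj (\<lambda>n::int. n + 1)" by (rule surjI[of _ "\<lambda>n. n - 1"]) simp
  \<comment> \<open>multiplying the base point by \<open>p\<close> shifts the exponent, which is a bijection of the integers\<close>
  hence "range (\<lambda>n::int. of_nat p powi n * y) = range ((\<lambda>n::int. of_nat p powi n * y) \<circ> (\<lambda>n. n + 1))"
    by (metis image_comp)
  also have "(\<lambda>n::int. of_nat p powi n * y) \<circ> (\<lambda>n. n + 1) = (\<lambda>n. of_nat p powi n * (of_nat p * y))"
    using p_gt_1 by (simp add: fun_eq_iff power_int_add mult.assoc)
  finally show ?thesis using assms p_gt_1 by (simp add: circle_class_eq)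
qed

lemma equivariant_scale:
  fixes F :: "real \<Rightarrow> rat \<Rightarrow> 'a"
  assumes "\<And>y q. y > 0 \<Longrightarrow> F (of_nat p * y) q = F y (of_nat p * q)" "y > 0"
  shows "F (of_nat p powi n * y) q = F y (of_nat p powi n * q)"
proof -
  have *: "F (of_nat p ^ m * y) q = F y (of_nat p ^ m * q)" if "y > 0" for m q and y :: real
    using that
  proof (induction m arbitrary: y q)
    case (Suc m)
    then show ?case using assms(1)[of "of_nat p ^ m * y"] p_gt_1 by (simp add: mult_ac)
  qed simp
  show ?thesis
  proof (cases "n \<ge> 0")
    case True
    then show ?thesis using *[OF assms(2)] by (simp add: power_int_def)
  next
    case False
    define m where "m = nat (- n)"
    \<comment> \<open>the case of the positive power \<open>m\<close> is applied at the point \<open>(p\<^sup>n y, p\<^sup>n q)\<close>\<close>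
    have cancel: "of_nat p ^ m * (inverse (of_nat p) ^ m * y) = y"
      "of_nat p ^ m * (inverse (of_nat p) ^ m * q) = q"
      using p_gt_1 by (simp_all flip: mult.assoc power_mult_distrib)
    have "F y (inverse (of_nat p) ^ m * q) =
        F (of_nat p ^ m * (inverse (of_nat p) ^ m * y)) (inverse (of_nat p) ^ m * q)"
      by (simp only: cancel)
    also have "\<dots> = F (inverse (of_nat p) ^ m * y) (of_nat p ^ m * (inverse (of_nat p) ^ m * q))"
      using assms(2) p_gt_1 by (intro *) simp
    also have "\<dots> = F (inverse (of_nat p) ^ m * y) q" by (simp only: cancel)
    finally show ?thesis using False by (simp add: power_int_def m_def)
  qed
qed

section \<open>Fourier sums on the foliated space\<close>

lemma coeff_smooth: "f \<in> coeff_algebra p \<Longrightarrow> smooth_on_pos (\<lambda>y. f y q)"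
  and coeff_invariant: "f \<in> coeff_algebra p \<Longrightarrow> y > 0 \<Longrightarrow> f (of_nat p * y) (q / of_nat p) = f y q"
  and coeff_support: "f \<in> coeff_algebra p \<Longrightarrow> compact K \<Longrightarrow> K \<subseteq> {0<..} \<Longrightarrow>
    \<exists>Q. finite Q \<and> (\<forall>y\<in>K. \<forall>q. q \<notin> Q \<longrightarrow> f y q = 0)"
  and coeff_nonpos: "f \<in> coeff_algebra p \<Longrightarrow> y \<le> 0 \<Longrightarrow> f y q = 0"
  by (auto simp: coeff_algebra_def)

lemma coeff_finite: "f \<in> coeff_algebra p \<Longrightarrow> finite {q. f y q \<noteq> 0}"
proof (cases "y > 0")
  case True
  assume "f \<in> coeff_algebra p"
  from coeff_support[OF this, of "{y}"] True obtain Q where "finite Q" "\<forall>q. q \<notin> Q \<longrightarrow> f y q = 0"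
    by auto
  thus ?thesis by (auto intro: finite_subset)
qed (simp add: coeff_nonpos)

lemma coeff_scale:
  assumes "f \<in> coeff_algebra p" "y > 0"
  shows "f (of_nat p powi n * y) q = f y (of_nat p powi n * q)"
proof (rule equivariant_scale[OF _ assms(2)])
  fix y :: real and q assume "y > 0"
  from coeff_invariant[OF assms(1) this, of "of_nat p * q"] p_gt_1
  show "f (of_nat p * y) q = f y (of_nat p * q)" by simp
qed

lemma coeff_diff:
  assumes f: "f \<in> coeff_algebra p" and g: "g \<in> coeff_algebra p"
  shows "f - g \<in> coeff_algebra p"
  unfolding coeff_algebra_def
proof (intro CollectI conjI allI impI)
  show "smooth_on_pos (\<lambda>y. (f - g) y q)" for q
    using smooth_on_pos_diff[OF coeff_smooth[OF f] coeff_smooth[OF g]] by simp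
  show "(f - g) (of_nat p * y) (q / of_nat p) = (f - g) y q" if "y > 0" for y q
    using coeff_invariant[OF f that] coeff_invariant[OF g that] by simp
  show "(f - g) y q = 0" if "y \<le> 0" for y q
    using coeff_nonpos[OF f that] coeff_nonpos[OF g that] by simp
  fix K :: "real set" assume K: "compact K \<and> K \<subseteq> {0<..}"
  obtain Q R where "finite Q" "\<forall>y\<in>K. \<forall>q. q \<notin> Q \<longrightarrow> f y q = 0"
    "finite R" "\<forall>y\<in>K. \<forall>q. q \<notin> R \<longrightarrow> g y q = 0"
    using coeff_support[OF f] coeff_support[OF g] K by meson
  thus "\<exists>Q. finite Q \<and> (\<forall>y\<in>K. \<forall>q. q \<notin> Q \<longrightarrow> (f - g) y q = 0)"
    by (intro exI[of _ "Q \<union> R"]) auto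
qed

lemma fourier_eq_sum:
  assumes "finite S" "\<And>q. f y q \<noteq> 0 \<Longrightarrow> q \<in> S"
  shows "fourier f (x, y) = (\<Sum>q\<in>S. f y q * adele_class_char q x)"
  unfolding fourier_def prod.case using assms by (intro sum.mono_neutral_left) auto

text \<open>
  Invariance on orbits: \<open>e\<^sub>q (p\<^sup>n x) = e\<^sub>r x\<close> and \<open>f (p\<^sup>n y, q) = f (y, r)\<close> with \<open>r = p\<^sup>n q\<close>, so that both sides
  are the same sum after reindexing by \<open>r\<close>.
\<close>

lemma fourier_scale:
  assumes f: "f \<in> coeff_algebra p" and y: "y > 0"
  shows "fourier f (adele_class_scale (of_nat p powi n) x, of_nat p powi n * y) = fourier f (x, y)"
  unfolding fourier_def prod.case
  by (rule sum.reindex_bij_witness[of _ "\<lambda>q. q / of_nat p powi n" "\<lambda>q. of_nat p powi n * q"])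
    (use p_gt_1 in \<open>simp_all add: coeff_scale[OF f y] adele_class_char_scale_powi\<close>)

lemma gamma_fun_class:
  assumes f: "f \<in> coeff_algebra p" and y: "y > 0"
  shows "gamma_fun p f (gamma_rel p `` {(x, y)}) = fourier f (x, y)"
proof -
  have "fourier f ` (gamma_rel p `` {(x, y)}) = {fourier f (x, y)}"
    by (simp add: gamma_class_eq[OF y] image_image fourier_scale[OF f y])
  thus ?thesis by (simp add: gamma_fun_def gamma_class_in_Gamma[OF y])
qed

lemma gamma_fun_outside: "c \<notin> Gamma p \<Longrightarrow> gamma_fun p f c = 0"
  by (simp add: gamma_fun_def)

lemma gamma_fun_eqI:
  assumes "\<And>c. c \<notin> Gamma p \<Longrightarrow> \<phi> c = 0" "f \<in> coeff_algebra p"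
    "\<And>x y. y > 0 \<Longrightarrow> \<phi> (gamma_rel p `` {(x, y)}) = fourier f (x, y)"
  shows "\<phi> = gamma_fun p f"
proof
  fix c show "\<phi> c = gamma_fun p f c"
    by (cases "c \<in> Gamma p") (auto simp: assms gamma_fun_outside gamma_fun_class elim!: Gamma_cases)
qed

lemma gamma_fun_diff:
  assumes f: "f \<in> coeff_algebra p" and g: "g \<in> coeff_algebra p"
  shows "gamma_fun p (f - g) = gamma_fun p f - gamma_fun p g"
proof (rule gamma_fun_eqI[OF _ coeff_diff[OF f g], symmetric])
  fix x and y :: real assume y: "y > 0"
  let ?S = "{q. f y q \<noteq> 0} \<union> {q. g y q \<noteq> 0}"
  have S: "finite ?S" using coeff_finite f g by simp
  show "(gamma_fun p f - gamma_fun p g) (gamma_rel p `` {(x, y)}) = fourier (f - g) (x, y)"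
  proof -
    have "fourier (f - g) (x, y) = (\<Sum>q\<in>?S. (f - g) y q * adele_class_char q x)"
      by (rule fourier_eq_sum[OF S]) auto
    moreover have "fourier f (x, y) = (\<Sum>q\<in>?S. f y q * adele_class_char q x)"
      "fourier g (x, y) = (\<Sum>q\<in>?S. g y q * adele_class_char q x)"
      by (rule fourier_eq_sum[OF S]; simp)+
    ultimately show ?thesis
      using f g y by (simp add: gamma_fun_class sum_subtractf left_diff_distrib)
  qed
qed (simp add: gamma_fun_outside)

text \<open>
  At each height \<open>y\<close> the Fourier sum is a finite linear combination of distinct characters, and
  these are linearly independent. Hence all of the complex can be computed on coefficients.
\<close>

lemma gamma_fun_inj: "inj_on (gamma_fun p) (coeff_algebra p)"
proof (rule inj_onI)
  fix f g assume f: "f \<in> coeff_algebra p" and g: "g \<in> coeff_algebra p" and eq: "gamma_fun p f = gamma_fun p g"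
  let ?h = "f - g"
  have h: "?h \<in> coeff_algebra p" using f g by (rule coeff_diff)
  have 0: "gamma_fun p ?h = 0" using gamma_fun_diff[OF f g] eq by simp
  have "?h y q = 0" for y q
  proof (cases "y > 0 \<and> ?h y q \<noteq> 0")
    case True
    hence y: "y > 0" by simp
    have "(\<Sum>q | ?h y q \<noteq> 0. ?h y q * adele_class_char q x) = 0" for x
      using gamma_fun_class[OF h y, of x] 0 by (simp add: fourier_def)
    from adele_class_char_independent[OF coeff_finite[OF h] this] True show ?thesis by blast
  next
    case False
    thus ?thesis using coeff_nonpos[OF h, of y q] by argo
  qed
  thus "f = g" by (simp add: fun_eq_iff)
qed

lemma coeff_of_gamma_fun: "f \<in> coeff_algebra p \<Longrightarrow> coeff_of p (gamma_fun p f) = f"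
  unfolding coeff_of_def by (rule inv_into_f_f[OF gamma_fun_inj])

section \<open>The derivations on coefficients\<close>

lemma coeff_has_derivative:
  assumes "f \<in> coeff_algebra p" "y > 0"
  shows "((\<lambda>s. f s q) has_vector_derivative vector_derivative (\<lambda>s. f s q) (at y)) (at y)"
  by (rule smooth_on_pos_has_vector_derivative[OF coeff_smooth[OF assms(1)] assms(2)])

lemma coeff_algebra_pointwise:
  assumes f: "f \<in> coeff_algebra p"
    and smooth: "\<And>q. smooth_on_pos (\<lambda>y. g y q)"
    and inv: "\<And>y q. y > 0 \<Longrightarrow> g (of_nat p * y) (q / of_nat p) = g y q"
    and zero: "\<And>y q. f y q = 0 \<Longrightarrow> g y q = 0"
  shows "g \<in> coeff_algebra p"
  unfolding coeff_algebra_def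
proof (intro CollectI conjI allI impI)
  fix K :: "real set" assume K: "compact K \<and> K \<subseteq> {0<..}"
  obtain Q where "finite Q" "\<forall>y\<in>K. \<forall>q. q \<notin> Q \<longrightarrow> f y q = 0"
    using coeff_support[OF f] K by meson
  thus "\<exists>Q. finite Q \<and> (\<forall>y\<in>K. \<forall>q. q \<notin> Q \<longrightarrow> g y q = 0)"
    using zero by meson
qed (use smooth inv zero coeff_nonpos[OF f] in auto)

lemma coeff_X_closed:
  assumes f: "f \<in> coeff_algebra p"
  shows "coeff_X f \<in> coeff_algebra p"
proof (rule coeff_algebra_pointwise[OF f])
  show "smooth_on_pos (\<lambda>y. coeff_X f y q)" for q
    unfolding coeff_X_def
    by (intro smooth_on_pos_mult smooth_on_pos_const smooth_on_pos_of_real coeff_smooth[OF f])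
  show "coeff_X f (of_nat p * y) (q / of_nat p) = coeff_X f y q" if "y > 0" for y q
    using coeff_invariant[OF f that, of q] p_gt_1 by (simp add: coeff_X_def of_rat_divide)
qed (simp add: coeff_X_def)

lemma coeff_div_X_closed:
  assumes f: "f \<in> coeff_algebra p"
  shows "coeff_div_X f \<in> coeff_algebra p"
proof (rule coeff_algebra_pointwise[OF f])
  show "smooth_on_pos (\<lambda>y. coeff_div_X f y q)" for q
    unfolding coeff_div_X_def
    by (intro smooth_on_pos_mult smooth_on_pos_const smooth_on_pos_inverse coeff_smooth[OF f])
  show "coeff_div_X f (of_nat p * y) (q / of_nat p) = coeff_div_X f y q" if "y > 0" for y q
    using coeff_invariant[OF f that, of q] p_gt_1 by (simp add: coeff_div_X_def of_rat_divide field_simps)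
qed (simp add: coeff_div_X_def)

text \<open>
  The delicate point is the support: \<open>f(\<cdot>, q) = 0\<close> on a compact \<open>K\<close> does not force the derivative to
  vanish on \<open>K\<close>, for instance at an isolated point. So the finite set of modes is taken from an
  interval whose interior contains \<open>K\<close>.
\<close>

lemma coeff_Y_closed:
  assumes f: "f \<in> coeff_algebra p"
  shows "coeff_Y f \<in> coeff_algebra p"
  unfolding coeff_algebra_def
proof (intro CollectI conjI allI impI)
  show "smooth_on_pos (\<lambda>y. coeff_Y f y q)" for q
    unfolding coeff_Y_def
    by (intro smooth_on_pos_mult smooth_on_pos_of_real smooth_on_pos_vector_derivative coeff_smooth[OF f])
  show "coeff_Y f (of_nat p * y) (q / of_nat p) = coeff_Y f y q" if y: "y > 0" for y q
  proof -
    let ?D = "vector_derivative (\<lambda>s. f s (q / of_nat p)) (at (of_nat p * y))"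
    have "((\<lambda>s. of_nat p * s) has_vector_derivative of_nat p) (at y)"
      by (auto intro!: derivative_eq_intros simp flip: has_real_derivative_iff_has_vector_derivative)
    from vector_diff_chain_at[OF this, of "\<lambda>s. f s (q / of_nat p)" ?D]
    have "((\<lambda>s. f (of_nat p * s) (q / of_nat p)) has_vector_derivative of_nat p *\<^sub>R ?D) (at y)"
      using coeff_has_derivative[OF f, of "of_nat p * y"] y p_gt_1 by (simp add: o_def)
    hence "((\<lambda>s. f s q) has_vector_derivative of_nat p *\<^sub>R ?D) (at y)"
      by (subst has_vector_derivative_cong_pos[OF y, of "\<lambda>s. f s q" "\<lambda>s. f (of_nat p * s) (q / of_nat p)"])
        (use coeff_invariant[OF f] in auto)
    from vector_derivative_at[OF this] show ?thesis
      by (simp add: coeff_Y_def scaleR_conv_of_real)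
  qed
  show "coeff_Y f y q = 0" if "y \<le> 0" for y q
  proof (cases "y = 0")
    case False
    with that have "y < 0" by simp
    hence "\<forall>\<^sub>F s in nhds y. f s q = 0"
      using eventually_nhds_in_open[of "{..<0}" y] coeff_nonpos[OF f] by (auto elim: eventually_mono)
    hence "((\<lambda>s. f s q) has_vector_derivative 0) (at y)"
      using has_vector_derivative_const[of 0 "at y"] \<open>y < 0\<close> coeff_nonpos[OF f]
      by (subst has_vector_derivative_cong_ev[where g = "\<lambda>s. 0"]) (auto elim: eventually_mono)
    thus ?thesis by (simp add: coeff_Y_def vector_derivative_at)
  qed (simp add: coeff_Y_def)
  fix K :: "real set" assume K: "compact K \<and> K \<subseteq> {0<..}"
  show "\<exists>Q. finite Q \<and> (\<forall>y\<in>K. \<forall>q. q \<notin> Q \<longrightarrow> coeff_Y f y q = 0)"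
  proof (cases "K = {}")
    case False
    obtain a where a: "a \<in> K" "\<And>y. y \<in> K \<Longrightarrow> a \<le> y"
      using compact_attains_inf[of K] K False by blast
    obtain b where b: "b \<in> K" "\<And>y. y \<in> K \<Longrightarrow> y \<le> b"
      using compact_attains_sup[of K] K False by blast
    have "a > 0" using a K by auto
    have "x > 0" if "x \<ge> a / 2" for x using that \<open>a > 0\<close> by linarith
    hence "{a / 2..b + 1} \<subseteq> {0<..}" by auto
    then obtain Q where Q: "finite Q" "\<forall>y\<in>{a / 2..b + 1}. \<forall>q. q \<notin> Q \<longrightarrow> f y q = 0"
      using coeff_support[OF f, of "{a / 2..b + 1}"] by auto
    have "coeff_Y f y q = 0" if y: "y \<in> K" and q: "q \<notin> Q" for y q
    proof -
      have y': "y \<in> {a / 2<..<b + 1}" using a(2)[OF y] b(2)[OF y] \<open>a > 0\<close> by simp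
      hence "\<forall>\<^sub>F s in nhds y. f s q = 0"
        using eventually_nhds_in_open[of "{a / 2<..<b + 1}" y] Q(2) q by (auto elim: eventually_mono)
      hence "((\<lambda>s. f s q) has_vector_derivative 0) (at y)"
        using has_vector_derivative_const[of 0 "at y"] y' Q(2) q
        by (subst has_vector_derivative_cong_ev[where g = "\<lambda>s. 0"]) (auto elim: eventually_mono)
      thus ?thesis by (simp add: coeff_Y_def vector_derivative_at)
    qed
    with Q(1) show ?thesis by blast
  qed auto
qed

section \<open>The zero mode and functions on the base\<close>

lemma zero_mode_closed:
  assumes "smooth_on_pos \<phi>" "\<And>y. y > 0 \<Longrightarrow> \<phi> (of_nat p * y) = \<phi> y"
  shows "zero_mode \<phi> \<in> coeff_algebra p"
  unfolding coeff_algebra_def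
proof (intro CollectI conjI allI impI)
  show "smooth_on_pos (\<lambda>y. zero_mode \<phi> y q)" for q
  proof (cases "q = 0")
    case True
    show ?thesis by (rule smooth_on_pos_cong[OF assms(1)]) (simp add: zero_mode_def True)
  next
    case False
    thus ?thesis using smooth_on_pos_const[of 0] by (simp add: zero_mode_def)
  qed
  show "zero_mode \<phi> (of_nat p * y) (q / of_nat p) = zero_mode \<phi> y q" if "y > 0" for y q
    using assms(2)[OF that] that p_gt_1 by (simp add: zero_mode_def)
  show "\<exists>Q. finite Q \<and> (\<forall>y\<in>K. \<forall>q. q \<notin> Q \<longrightarrow> zero_mode \<phi> y q = 0)" for K
    by (rule exI[of _ "{0}"]) (simp add: zero_mode_def)
qed (simp add: zero_mode_def)

lemma coeff_Y_zero_mode: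
  "coeff_Y (zero_mode \<phi>) y 0 = of_real y * vector_derivative \<phi> (at y)" if "y > 0"
  by (rule coeff_Y_cong[OF that]) (simp add: zero_mode_def)

lemma coeff_Y_zero_mode_nonzero: "q \<noteq> 0 \<Longrightarrow> coeff_Y (zero_mode \<phi>) y q = 0"
  by (simp add: coeff_Y_def zero_mode_def)

lemma base_coeff_closed: "h \<in> circle_smooth p \<Longrightarrow> base_coeff p h \<in> coeff_algebra p"
  unfolding base_coeff_def circle_smooth_def
  by (rule zero_mode_closed) (simp_all add: circle_class_scale)

lemma circle_fun_class:
  assumes "f \<in> coeff_algebra p" "y > 0"
  shows "circle_fun p f (circle_rel p `` {y}) = f y 0"
proof -
  have "(\<lambda>y. f y 0) ` (circle_rel p `` {y}) = {f y 0}"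
    by (simp add: circle_class_eq[OF assms(2)] image_image coeff_scale[OF assms])
  thus ?thesis by (simp add: circle_fun_def circle_class_in_circle[OF assms(2)])
qed

lemma circle_fun_smooth:
  assumes "f \<in> coeff_algebra p"
  shows "circle_fun p f \<in> circle_smooth p"
proof -
  have "smooth_on_pos (\<lambda>y. circle_fun p f (circle_rel p `` {y}))"
    by (rule smooth_on_pos_cong[OF coeff_smooth[OF assms, of 0]]) (simp add: circle_fun_class[OF assms])
  thus ?thesis by (simp add: circle_smooth_def circle_fun_def)
qed

lemma base_coeff_circle_fun:
  assumes "f \<in> coeff_algebra p"
  shows "base_coeff p (circle_fun p f) y q = (if q = 0 then f y 0 else 0)"
  using coeff_nonpos[OF assms, of y] by (auto simp: base_coeff_def zero_mode_def circle_fun_class[OF assms])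

lemma circle_fun_base_coeff:
  assumes "h \<in> circle_smooth p"
  shows "circle_fun p (base_coeff p h) = h"
proof
  fix c show "circle_fun p (base_coeff p h) c = h c"
  proof (cases "c \<in> circle p")
    case True
    then obtain y where "y > 0" "c = circle_rel p `` {y}" by (rule circle_cases)
    thus ?thesis
      using circle_fun_class[OF base_coeff_closed[OF assms]] by (simp add: base_coeff_def zero_mode_def)
  qed (use assms in \<open>simp add: circle_fun_def circle_smooth_def\<close>)
qed

text \<open>
  Identifying functions on the base with zero modes turns the differential of the circle into \<open>Y\<close>;
  in particular it inherits that the value at \<open>y\<close> only depends on the orbit of \<open>y\<close>.
\<close>

lemma circle_d_eq:
  assumes "h \<in> circle_smooth p"
  shows "circle_d p h = circle_fun p (coeff_Y (base_coeff p h))"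
proof
  fix c
  show "circle_d p h c = circle_fun p (coeff_Y (base_coeff p h)) c"
  proof (cases "c \<in> circle p")
    case True
    then obtain y where y: "y > 0" "c = circle_rel p `` {y}" by (rule circle_cases)
    have "(\<lambda>y. complex_of_real y * vector_derivative (\<lambda>s. h (circle_rel p `` {s})) (at y)) ` c
        = (\<lambda>y. coeff_Y (base_coeff p h) y 0) ` c"
      using y p_gt_1 by (intro image_cong)
        (auto simp: circle_class_eq base_coeff_def coeff_Y_zero_mode)
    thus ?thesis by (simp add: circle_d_def circle_fun_def)
  qed (simp add: circle_d_def circle_fun_def)
qed

lemma circle_d_smooth: "h \<in> circle_smooth p \<Longrightarrow> circle_d p h \<in> circle_smooth p"
  by (simp add: circle_d_eq circle_fun_smooth coeff_Y_closed base_coeff_closed)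

lemma coeff_Y_base_coeff:
  assumes "h \<in> circle_smooth p"
  shows "coeff_Y (base_coeff p h) = base_coeff p (circle_d p h)"
proof (intro ext)
  fix y q
  show "coeff_Y (base_coeff p h) y q = base_coeff p (circle_d p h) y q"
    unfolding circle_d_eq[OF assms] base_coeff_circle_fun[OF coeff_Y_closed[OF base_coeff_closed[OF assms]]]
    by (simp add: base_coeff_def coeff_Y_zero_mode_nonzero)
qed

lemma pullback0_eq:
  assumes "h \<in> circle_smooth p"
  shows "pullback0 p h = gamma_fun p (base_coeff p h)"
proof (rule gamma_fun_eqI[OF _ base_coeff_closed[OF assms]])
  fix x and y :: real assume y: "y > 0"
  have "fourier (base_coeff p h) (x, y) = (\<Sum>q\<in>{0}. base_coeff p h y q * adele_class_char q x)"
    by (rule fourier_eq_sum) (auto simp: base_coeff_def zero_mode_def split: if_splits)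
  thus "pullback0 p h (gamma_rel p `` {(x, y)}) = fourier (base_coeff p h) (x, y)"
    using y by (simp add: pullback0_def gamma_class_in_Gamma Gamma_proj_class
      base_coeff_def zero_mode_def adele_class_char_0)
qed (simp add: pullback0_def)

section \<open>The leafwise differentials on coefficients\<close>

lemma leaf_d0_gamma_fun:
  "f \<in> coeff_algebra p \<Longrightarrow> leaf_d0 p (gamma_fun p f) = (gamma_fun p (coeff_X f), gamma_fun p (coeff_Y f))"
  by (simp add: leaf_d0_def deriv_X_def deriv_Y_def coeff_of_gamma_fun coeff_X_def coeff_Y_def)

lemma leaf_d1_gamma_fun:
  assumes "f \<in> coeff_algebra p" "g \<in> coeff_algebra p"
  shows "leaf_d1 p (gamma_fun p f, gamma_fun p g) = gamma_fun p (f - (coeff_Y f - coeff_X g))"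
  using assms
  by (simp add: leaf_d1_def wedge_def leaf_d0_gamma_fun form_alpha_def form_beta_def d_alpha_def
    gamma_fun_diff coeff_diff coeff_X_closed coeff_Y_closed)

text \<open>
  The homotopy behind the theorem: division inverts \<open>X\<close> except on the zero mode, which is exactly the
  part of \<open>f\<close> that comes from the base.
\<close>

lemma coeff_X_div_X:
  assumes "f \<in> coeff_algebra p"
  shows "coeff_X (coeff_div_X f) = f - base_coeff p (circle_fun p f)"
proof (intro ext)
  fix y q
  let ?c = "2 * complex_of_real pi * \<i> * of_rat q"
  have "coeff_X (coeff_div_X f) y q = (?c * inverse ?c) * (of_real y * inverse (of_real y)) * f y q"
    unfolding coeff_X_def coeff_div_X_def by (simp only: mult_ac)
  also have "\<dots> = (f - base_coeff p (circle_fun p f)) y q"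
    using coeff_nonpos[OF assms, of 0 q]
    by (cases "y = 0"; cases "q = 0")
      (simp_all add: base_coeff_circle_fun[OF assms] right_inverse del: inverse_mult_distrib)
  finally show "coeff_X (coeff_div_X f) y q = (f - base_coeff p (circle_fun p f)) y q" .
qed

lemma coeff_X_base_coeff: "coeff_X (base_coeff p h) = 0"
  by (auto simp: coeff_X_def base_coeff_def zero_mode_def fun_eq_iff)

lemma coeff_X_eq_0:
  assumes "f \<in> coeff_algebra p" "coeff_X f = 0"
  shows "f = base_coeff p (circle_fun p f)"
proof (intro ext)
  fix y q
  have "coeff_X f y q = 0" using assms(2) by simp
  thus "f y q = base_coeff p (circle_fun p f) y q"
    using coeff_nonpos[OF assms(1), of 0 q]
    by (auto simp: base_coeff_circle_fun[OF assms(1)] coeff_X_def)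
qed

section \<open>The Euler equation on the circle\<close>

text \<open>
  The solutions of \<open>\<phi> = y \<phi>'\<close> are the multiples of \<open>y\<close>, and \<open>c p y = c y\<close> forces \<open>c = 0\<close> as \<open>p \<noteq> 1\<close>.
\<close>

lemma periodic_euler_homogeneous:
  assumes deriv: "\<And>y. y > 0 \<Longrightarrow> (\<phi> has_vector_derivative \<phi>' y) (at y)"
    and euler: "\<And>y. y > 0 \<Longrightarrow> \<phi> y = of_real y * \<phi>' y"
    and periodic: "\<And>y. y > 0 \<Longrightarrow> \<phi> (of_nat p * y) = \<phi> y"
    and y: "y > (0::real)"
  shows "\<phi> y = (0::complex)"
proof -
  let ?i = "\<lambda>y. inverse (complex_of_real y)"
  have const: "((\<lambda>y. ?i y * \<phi> y) has_vector_derivative 0) (at y)" if "y > 0" for y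
  proof -
    have "((\<lambda>y. ?i y * \<phi> y) has_vector_derivative ?i y * \<phi>' y + - (?i y * ?i y) * \<phi> y) (at y)"
      using deriv[OF that] inverse_of_real_has_vector_derivative[of y] that
      by (intro has_vector_derivative_mult) auto
    also have "?i y * \<phi>' y + - (?i y * ?i y) * \<phi> y = 0"
      using euler[OF that] that by (simp add: field_simps)
    finally show ?thesis .
  qed
  then obtain c where c: "\<And>y. y > 0 \<Longrightarrow> ?i y * \<phi> y = c"
    using constant_on_pos[OF const] by blast
  have phi: "\<phi> y = c * of_real y" if "y > 0" for y using c[OF that] that by (simp add: field_simps)
  have "c * of_real (of_nat p * y) = c * of_real y" 
    using phi[of "of_nat p * y"] phi[OF y] periodic[OF y] y p_gt_1 by simp
  hence "c = 0" using y p_gt_1 by simp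
  with phi[OF y] show ?thesis by simp
qed

text \<open>
  With \<open>\<phi> = y w\<close> the equation \<open>\<phi> - y \<phi>' = u\<close> becomes \<open>w' = - u / y\<^sup>2\<close>, which has a solution on the
  half-line. The function \<open>\<phi>(p y) - \<phi>(y)\<close> solves the homogeneous equation, so it is \<open>K y\<close> for
  a constant \<open>K\<close>; subtracting the homogeneous solution \<open>K y / (p - 1)\<close> from \<open>\<phi>\<close> makes it invariant.
\<close>

lemma periodic_euler_solvable:
  assumes smooth: "smooth_on_pos u" and periodic: "\<And>y. y > 0 \<Longrightarrow> u (of_nat p * y) = u y"
  obtains \<phi> where "smooth_on_pos \<phi>" "\<And>y. y > 0 \<Longrightarrow> \<phi> (of_nat p * y) = \<phi> y"
    "\<And>y. y > 0 \<Longrightarrow> \<phi> y - of_real y * vector_derivative \<phi> (at y) = u y"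
proof -
  let ?i = "\<lambda>y. inverse (complex_of_real y)" and ?P = "of_nat p :: complex"
  define v where "v y = - 1 * (?i y * (?i y * u y))" for y
  have v_smooth: "smooth_on_pos v" unfolding v_def
    by (intro smooth_on_pos_mult smooth_on_pos_const smooth_on_pos_inverse smooth)
  have "isCont v y" if "y > 0" for y
    using smooth_on_pos_has_vector_derivative[OF v_smooth that] has_vector_derivative_continuous by blast
  then obtain w where w: "\<And>y. y > 0 \<Longrightarrow> (w has_vector_derivative v y) (at y)"
    using einterval_antiderivative[of 0 \<infinity> v] by (auto simp: zero_ereal_def)
  have const: "((\<lambda>y. ?P * w (of_nat p * y) - w y) has_vector_derivative 0) (at y)" if "y > 0" for y
  proof -
    have "((\<lambda>s. of_nat p * s) has_vector_derivative of_nat p) (at y)"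
      by (auto intro!: derivative_eq_intros simp flip: has_real_derivative_iff_has_vector_derivative)
    from vector_diff_chain_at[OF this, of w] w[of "of_nat p * y"] that p_gt_1
    have "((\<lambda>y. w (of_nat p * y)) has_vector_derivative of_nat p *\<^sub>R v (of_nat p * y)) (at y)"
      by (simp add: o_def)
    hence "((\<lambda>y. ?P * w (of_nat p * y) - w y) has_vector_derivative
        ?P * (of_nat p *\<^sub>R v (of_nat p * y)) - v y) (at y)"
      using w[OF that] by (intro has_vector_derivative_diff has_vector_derivative_mult_right) auto
    moreover have "?P * (of_nat p *\<^sub>R v (of_nat p * y)) - v y = 0"
      using p_gt_1 periodic[OF that] that by (simp add: v_def scaleR_conv_of_real field_simps)
    ultimately show ?thesis by simp
  qed
  then obtain K where K: "\<And>y. y > 0 \<Longrightarrow> ?P * w (of_nat p * y) - w y = K"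
    using constant_on_pos[OF const] by blast
  have w_smooth: "smooth_on_pos w" by (rule smooth_on_pos_antiderivative[OF v_smooth w])
  define k where "k = K / (?P - 1)"
  have p1: "?P - 1 \<noteq> 0" using p_gt_1 by auto
  define \<phi> where "\<phi> y = of_real y * (w y - k)" for y
  have "smooth_on_pos \<phi>" unfolding \<phi>_def
    by (intro smooth_on_pos_mult smooth_on_pos_of_real smooth_on_pos_diff w_smooth smooth_on_pos_const)
  moreover have "\<phi> (of_nat p * y) = \<phi> y" if "y > 0" for y
  proof -
    have "?P * (w (of_nat p * y) - k) = K + w y - ?P * k" using K[OF that] by (simp add: algebra_simps)
    also have "K = (?P - 1) * k" using p1 by (simp add: k_def)
    finally have "?P * (w (of_nat p * y) - k) = w y - k" by (simp add: algebra_simps)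
    thus ?thesis by (simp add: \<phi>_def mult_ac)
  qed
  moreover have "\<phi> y - of_real y * vector_derivative \<phi> (at y) = u y" if "y > 0" for y
  proof -
    have "((\<lambda>y. w y - k) has_vector_derivative v y) (at y)"
      using has_vector_derivative_diff[OF w[OF that] has_vector_derivative_const] by simp
    moreover have "(complex_of_real has_vector_derivative 1) (at y)"
      using has_vector_derivative_of_real[OF DERIV_ident[of "at y"]] by simp
    ultimately have "(\<phi> has_vector_derivative of_real y * v y + 1 * (w y - k)) (at y)"
      unfolding \<phi>_def by (intro has_vector_derivative_mult)
    hence "vector_derivative \<phi> (at y) = of_real y * v y + 1 * (w y - k)"
      by (rule vector_derivative_at)
    thus ?thesis using that by (simp add: \<phi>_def v_def field_simps)
  qed
  ultimately show thesis by (rule that)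
qed

section \<open>Exactness modulo the base\<close>

text \<open>
  Let \<open>f \<alpha> + g \<beta>\<close> be closed, that is \<open>f - Y f + X g = 0\<close>. Its mode \<open>q = 0\<close> is the homogeneous Euler equation, so
  \<open>f\<close> has no zero mode and \<open>f = X k\<close> for \<open>k = f / (2 \<pi> \<i> y q)\<close>. For \<open>q \<noteq> 0\<close> the extra factor \<open>1 / y\<close> in \<open>k\<close>
  gives \<open>Y k = (Y f - f) / (2 \<pi> \<i> y q)\<close>, which is \<open>g\<close> by closedness. What remains of \<open>g\<close> is its
  zero mode.
\<close>

lemma cocycle_exact_modulo_base:
  assumes f: "f \<in> coeff_algebra p" and g: "g \<in> coeff_algebra p"
    and cocycle: "f - (coeff_Y f - coeff_X g) = 0"
  shows "coeff_X (coeff_div_X f) = f"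
    and "coeff_Y (coeff_div_X f) = g - base_coeff p (circle_fun p g)"
proof -
  have eq: "f y q = coeff_Y f y q - coeff_X g y q" for y q
    using fun_cong[OF fun_cong[OF cocycle, of y], of q] by simp
  have "f y 0 = 0" for y
  proof (cases "y > 0")
    case True
    show ?thesis
    proof (rule periodic_euler_homogeneous[OF coeff_has_derivative[OF f]])
      show "f y 0 = complex_of_real y * vector_derivative (\<lambda>s. f s 0) (at y)" for y
        using eq[of y 0] by (simp add: coeff_X_def coeff_Y_def)
      show "f (of_nat p * y) 0 = f y 0" if "y > 0" for y
        using coeff_invariant[OF f that, of 0] by simp
    qed (use True in auto)
  qed (simp add: coeff_nonpos[OF f])
  hence "base_coeff p (circle_fun p f) = 0"
    by (simp add: fun_eq_iff base_coeff_circle_fun[OF f])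
  thus "coeff_X (coeff_div_X f) = f" by (simp add: coeff_X_div_X[OF f])
  show "coeff_Y (coeff_div_X f) = g - base_coeff p (circle_fun p g)"
  proof (intro ext)
    fix y q
    define c where "c = 2 * complex_of_real pi * \<i> * of_rat q"
    let ?i = "inverse (complex_of_real y)" and ?f' = "vector_derivative (\<lambda>s. f s q) (at y)"
    consider "y \<le> 0" | "q = 0" | "y > 0" "q \<noteq> 0" by linarith
    thus "coeff_Y (coeff_div_X f) y q = (g - base_coeff p (circle_fun p g)) y q"
    proof cases
      case 1
      thus ?thesis
        using coeff_nonpos[OF coeff_Y_closed[OF coeff_div_X_closed[OF f]]] coeff_nonpos[OF g]
        by (simp add: base_coeff_circle_fun[OF g])
    next
      case 2
      thus ?thesis by (simp add: base_coeff_circle_fun[OF g] coeff_Y_def coeff_div_X_def)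
    next
      case 3
      have c: "c \<noteq> 0" using 3 by (simp add: c_def)
      have "((\<lambda>s. coeff_div_X f s q) has_vector_derivative
          inverse c * (?i * ?f' + - (?i * ?i) * f y q)) (at y)"
        unfolding coeff_div_X_def c_def[symmetric] using 3
        by (intro has_vector_derivative_mult_right has_vector_derivative_mult
          inverse_of_real_has_vector_derivative coeff_has_derivative[OF f]) auto
      hence "coeff_Y (coeff_div_X f) y q =
          inverse c * (of_real y * ?i) * (?f' - ?i * f y q)"
        by (simp add: coeff_Y_def vector_derivative_at right_diff_distrib mult_ac)
      also have "\<dots> = inverse c * ?i * (of_real y * ?f' - f y q)"
        using 3 by (simp add: algebra_simps)
      also have "of_real y * ?f' - f y q = c * (of_real y * g y q)"
        using eq[of y q] by (simp add: c_def coeff_X_def coeff_Y_def algebra_simps)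
      also have "inverse c * ?i * \<dots> = (inverse c * c) * (?i * of_real y) * g y q"
        by (simp only: mult_ac)
      also have "\<dots> = g y q" using c 3 by simp
      finally show ?thesis using 3 by (simp add: base_coeff_circle_fun[OF g])
    qed
  qed
qed

text \<open>
  Every 2-form is exact. The modes \<open>q \<noteq> 0\<close> of \<open>u\<close> are in the image of \<open>X\<close>; the mode \<open>q = 0\<close> is in the image of
  \<open>f \<mapsto> f - Y f\<close>, where the term \<open>f\<close> comes from \<open>d \<alpha> = \<alpha> \<and> \<beta>\<close>.
\<close>

lemma coeff_d1_surj:
  assumes u: "u \<in> coeff_algebra p"
  obtains f where "f \<in> coeff_algebra p"
    "f - (coeff_Y f - coeff_X (coeff_div_X u)) = u"
proof -
  obtain \<phi> where \<phi>: "smooth_on_pos \<phi>" "\<And>y. y > 0 \<Longrightarrow> \<phi> (of_nat p * y) = \<phi> y"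
    "\<And>y. y > 0 \<Longrightarrow> \<phi> y - of_real y * vector_derivative \<phi> (at y) = u y 0"
    using periodic_euler_solvable[OF coeff_smooth[OF u, of 0]] coeff_invariant[OF u, of _ 0] by auto
  have closed: "zero_mode \<phi> \<in> coeff_algebra p" using \<phi> by (intro zero_mode_closed)
  have "zero_mode \<phi> y q - coeff_Y (zero_mode \<phi>) y q = base_coeff p (circle_fun p u) y q" for y q
  proof (cases "q = 0 \<and> y > 0")
    case True
    thus ?thesis using \<phi>(3)[of y]
      by (simp add: coeff_Y_zero_mode base_coeff_circle_fun[OF u]) (simp add: zero_mode_def)
  next
    case False
    thus ?thesis
      using coeff_nonpos[OF closed, of y] coeff_nonpos[OF coeff_Y_closed[OF closed], of y]
      by (cases "q = 0") (auto simp: base_coeff_circle_fun[OF u] coeff_nonpos[OF u]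
        coeff_Y_zero_mode_nonzero, simp add: zero_mode_def)
  qed
  hence "zero_mode \<phi> - (coeff_Y (zero_mode \<phi>) - coeff_X (coeff_div_X u)) = u"
    by (simp add: coeff_X_div_X[OF u] fun_eq_iff algebra_simps)
  with closed show thesis by (rule that)
qed

section \<open>Linearity of the two complexes\<close>

lemma coeff_X_diff: "coeff_X (f - g) = coeff_X f - coeff_X g"
  by (simp add: coeff_X_def fun_eq_iff algebra_simps)

lemma coeff_Y_diff:
  assumes f: "f \<in> coeff_algebra p" and g: "g \<in> coeff_algebra p"
  shows "coeff_Y (f - g) = coeff_Y f - coeff_Y g"
proof (intro ext)
  fix y q
  show "coeff_Y (f - g) y q = (coeff_Y f - coeff_Y g) y q"
  proof (cases "y > 0")
    case True
    from has_vector_derivative_diff[OF coeff_has_derivative[OF f True, of q] coeff_has_derivative[OF g True, of q],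
        THEN vector_derivative_at]
    show ?thesis by (simp add: coeff_Y_def right_diff_distrib)
  qed (simp add: coeff_nonpos coeff_Y_closed coeff_diff f g)
qed

lemma zero_in_coeff: "0 \<in> coeff_algebra p"
  using zero_mode_closed[OF smooth_on_pos_const[of 0]] by (simp add: zero_mode_def zero_fun_def)

lemma gamma_fun_0: "gamma_fun p 0 = 0"
  using gamma_fun_diff[OF zero_in_coeff zero_in_coeff] by simp

lemma gamma_fun_eq_0_iff: "f \<in> coeff_algebra p \<Longrightarrow> gamma_fun p f = 0 \<longleftrightarrow> f = 0"
  using inj_onD[OF gamma_fun_inj _ _ zero_in_coeff, of f] by (auto simp: gamma_fun_0)

lemma gamma_algebra_cases:
  assumes "\<phi> \<in> gamma_algebra p"
  obtains f where "f \<in> coeff_algebra p" "\<phi> = gamma_fun p f"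
  using assms by (auto simp: gamma_algebra_def)

lemma gamma_fun_in_algebra: "f \<in> coeff_algebra p \<Longrightarrow> gamma_fun p f \<in> gamma_algebra p"
  by (simp add: gamma_algebra_def)

lemma base_coeff_inj:
  "h \<in> circle_smooth p \<Longrightarrow> h' \<in> circle_smooth p \<Longrightarrow> base_coeff p h = base_coeff p h' \<Longrightarrow> h = h'"
  by (metis circle_fun_base_coeff)

lemma base_coeff_diff: "base_coeff p (h - h') = base_coeff p h - base_coeff p h'"
  by (simp add: base_coeff_def zero_mode_def fun_eq_iff)

lemma base_coeff_0: "base_coeff p 0 = 0"
  by (simp add: base_coeff_def zero_mode_def fun_eq_iff)

lemma circle_smooth_subgroup: "is_subgroup (circle_smooth p)"
  using smooth_on_pos_const[of 0] by (auto simp: is_subgroup_def circle_smooth_def smooth_on_pos_diff)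

lemma circle_d_diff:
  assumes h: "h \<in> circle_smooth p" and h': "h' \<in> circle_smooth p"
  shows "circle_d p (h - h') = circle_d p h - circle_d p h'"
proof (rule base_coeff_inj)
  have "h - h' \<in> circle_smooth p" "circle_d p h - circle_d p h' \<in> circle_smooth p"
    using circle_smooth_subgroup h h' circle_d_smooth by (auto simp: is_subgroup_def)
  thus "circle_d p (h - h') \<in> circle_smooth p" "circle_d p h - circle_d p h' \<in> circle_smooth p"
    "base_coeff p (circle_d p (h - h')) = base_coeff p (circle_d p h - circle_d p h')"
    using h h' by (simp_all add: circle_d_smooth base_coeff_diff flip: coeff_Y_base_coeff)
      (simp add: coeff_Y_diff base_coeff_closed)
qed

lemma gamma_algebra_subgroup: "is_subgroup (gamma_algebra p)"
  unfolding gamma_algebra_def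
  by (rule is_subgroup_image) (auto simp: is_subgroup_def zero_in_coeff coeff_diff gamma_fun_diff)

lemma leaf_forms1_subgroup: "is_subgroup (leaf_forms1 p)"
  using gamma_algebra_subgroup by (auto simp: is_subgroup_def leaf_forms1_def zero_prod_def)

lemma leaf_d0_diff:
  assumes "\<phi> \<in> gamma_algebra p" "\<psi> \<in> gamma_algebra p"
  shows "leaf_d0 p (\<phi> - \<psi>) = leaf_d0 p \<phi> - leaf_d0 p \<psi>"
  using assms
  by (auto elim!: gamma_algebra_cases simp: leaf_d0_gamma_fun coeff_diff coeff_X_diff coeff_Y_diff
    coeff_X_closed coeff_Y_closed simp flip: gamma_fun_diff)

lemma wedge_diff_left: "wedge (a - b) \<theta> = wedge a \<theta> - wedge b \<theta>"
  by (simp add: wedge_def algebra_simps)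

lemma leaf_d1_diff:
  assumes "\<omega> \<in> leaf_forms1 p" "\<eta> \<in> leaf_forms1 p"
  shows "leaf_d1 p (\<omega> - \<eta>) = leaf_d1 p \<omega> - leaf_d1 p \<eta>"
  using assms by (auto simp: leaf_forms1_def leaf_d1_def leaf_d0_diff wedge_diff_left algebra_simps)

section \<open>The pull-back in cohomology\<close>

lemma pullback0_eq_0:
  assumes "h \<in> circle_smooth p" "pullback0 p h = 0"
  shows "h = 0"
proof (rule base_coeff_inj[OF assms(1)])
  show "0 \<in> circle_smooth p" using circle_smooth_subgroup by (simp add: is_subgroup_def)
  show "base_coeff p h = base_coeff p 0"
    using assms by (simp add: pullback0_eq base_coeff_0 gamma_fun_eq_0_iff base_coeff_closed)
qed

lemma pullback0_closed: "h \<in> circle_smooth p \<Longrightarrow> pullback0 p h \<in> gamma_algebra p"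
  by (simp add: pullback0_eq gamma_fun_in_algebra base_coeff_closed)

lemma pullback1_closed: "h \<in> circle_smooth p \<Longrightarrow> pullback1 p h \<in> leaf_forms1 p"
  using gamma_algebra_subgroup
  by (simp add: pullback1_def leaf_forms1_def pullback0_closed is_subgroup_def)

lemma leaf_d0_pullback0:
  "h \<in> circle_smooth p \<Longrightarrow> leaf_d0 p (pullback0 p h) = pullback1 p (circle_d p h)"
  by (simp add: pullback0_eq leaf_d0_gamma_fun base_coeff_closed coeff_X_base_coeff gamma_fun_0
    coeff_Y_base_coeff pullback1_def circle_d_smooth)

lemma leaf_d1_pullback1:
  assumes "h \<in> circle_smooth p"
  shows "leaf_d1 p (pullback1 p h) = 0"
proof -
  have "coeff_Y 0 = 0" using coeff_Y_diff[OF zero_in_coeff zero_in_coeff] by simp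
  thus ?thesis
    using leaf_d1_gamma_fun[OF zero_in_coeff base_coeff_closed[OF assms]]
    by (simp add: pullback1_def pullback0_eq assms gamma_fun_0 coeff_X_base_coeff)
qed

lemma pullback0_add: "pullback0 p (h + h') = pullback0 p h + pullback0 p h'"
  by (simp add: pullback0_def fun_eq_iff)

lemma pullback0_scale: "pullback0 p (scale_fn a h) = scale_fn a (pullback0 p h)"
  by (simp add: pullback0_def scale_fn_def fun_eq_iff)

text \<open>
  \<open>X f = 0\<close> leaves only the zero mode of \<open>f\<close>, so that invariant functions come from the base.
\<close>

lemma cohomology_iso_degree_0:
  "cohomology_iso scale_fn scale_fn (pullback0 p)
    {h \<in> circle_smooth p. circle_d p h = 0} {0} {f \<in> leaf_forms0 p. leaf_d0 p f = 0} {0}"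
  unfolding leaf_forms0_def
proof (rule cohomology_isoI)
  show "is_subgroup {h \<in> circle_smooth p. circle_d p h = 0}"
    by (rule is_subgroup_kernel[OF circle_smooth_subgroup]) (rule circle_d_diff)
  show "is_subgroup {f \<in> gamma_algebra p. leaf_d0 p f = 0}"
    by (rule is_subgroup_kernel[OF gamma_algebra_subgroup]) (rule leaf_d0_diff)
  show "pullback0 p ` {h \<in> circle_smooth p. circle_d p h = 0} \<subseteq> {f \<in> gamma_algebra p. leaf_d0 p f = 0}"
    by (auto simp: pullback0_closed leaf_d0_pullback0)
      (simp add: pullback1_def pullback0_def zero_prod_def fun_eq_iff)
  fix \<phi> assume "\<phi> \<in> {f \<in> gamma_algebra p. leaf_d0 p f = 0}"
  then obtain f where f: "f \<in> coeff_algebra p" "\<phi> = gamma_fun p f" and d: "leaf_d0 p \<phi> = 0"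
    by (auto elim: gamma_algebra_cases)
  hence XY: "coeff_X f = 0" "coeff_Y f = 0"
    by (auto simp: leaf_d0_gamma_fun zero_prod_def gamma_fun_eq_0_iff coeff_X_closed coeff_Y_closed)
  let ?h = "circle_fun p f"
  have h: "?h \<in> circle_smooth p" by (rule circle_fun_smooth[OF f(1)])
  have \<phi>: "\<phi> = pullback0 p ?h"
    using coeff_X_eq_0[OF f(1) XY(1)] f(2) by (simp add: pullback0_eq[OF h])
  hence "pullback1 p (circle_d p ?h) = 0" using d by (simp add: leaf_d0_pullback0[OF h])
  hence "circle_d p ?h = 0"
    by (intro pullback0_eq_0 circle_d_smooth h) (simp add: pullback1_def zero_prod_def)
  with h \<phi> show "\<exists>h\<in>{h \<in> circle_smooth p. circle_d p h = 0}. \<phi> - pullback0 p h \<in> {0}" by auto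
qed (auto simp: is_subgroup_def pullback0_add pullback0_scale pullback0_eq_0, simp add: pullback0_def fun_eq_iff)

text \<open>
  Injectivity: if \<open>h \<beta> = d k\<close>, then \<open>X k = 0\<close>, so \<open>k\<close> itself comes from the base and \<open>h \<beta>\<close> is exact there.
  Surjectivity is \<open>cocycle_exact_modulo_base\<close>.
\<close>

lemma cohomology_iso_degree_1:
  "cohomology_iso scale_fn scale_pair (pullback1 p)
    (circle_smooth p) (circle_d p ` circle_smooth p)
    {\<omega> \<in> leaf_forms1 p. leaf_d1 p \<omega> = 0} (leaf_d0 p ` leaf_forms0 p)"
  unfolding leaf_forms0_def
proof (rule cohomology_isoI)
  show "is_subgroup (circle_smooth p)" by (rule circle_smooth_subgroup)
  show "is_subgroup (circle_d p ` circle_smooth p)"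
    by (rule is_subgroup_image[OF circle_smooth_subgroup]) (rule circle_d_diff)
  show "is_subgroup {\<omega> \<in> leaf_forms1 p. leaf_d1 p \<omega> = 0}"
    by (rule is_subgroup_kernel[OF leaf_forms1_subgroup]) (rule leaf_d1_diff)
  show "is_subgroup (leaf_d0 p ` gamma_algebra p)"
    by (rule is_subgroup_image[OF gamma_algebra_subgroup]) (rule leaf_d0_diff)
  show "pullback1 p ` circle_smooth p \<subseteq> {\<omega> \<in> leaf_forms1 p. leaf_d1 p \<omega> = 0}"
    by (auto simp: pullback1_closed leaf_d1_pullback1)
  show "pullback1 p ` circle_d p ` circle_smooth p \<subseteq> leaf_d0 p ` gamma_algebra p"
    using leaf_d0_pullback0 pullback0_closed by (auto simp: image_iff) metis
next
  fix h assume h: "h \<in> circle_smooth p" and "pullback1 p h \<in> leaf_d0 p ` gamma_algebra p"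
  then obtain k where k: "k \<in> coeff_algebra p" and "pullback1 p h = leaf_d0 p (gamma_fun p k)"
    by (auto elim: gamma_algebra_cases)
  hence "gamma_fun p (coeff_X k) = 0" and hk: "pullback0 p h = gamma_fun p (coeff_Y k)"
    by (auto simp: pullback1_def leaf_d0_gamma_fun)
  hence "coeff_X k = 0" using k by (simp add: gamma_fun_eq_0_iff coeff_X_closed)
  hence k_eq: "k = base_coeff p (circle_fun p k)" by (rule coeff_X_eq_0[OF k])
  have h': "circle_fun p k \<in> circle_smooth p" by (rule circle_fun_smooth[OF k])
  have "base_coeff p h = coeff_Y k"
    using hk h k by (auto simp: pullback0_eq base_coeff_closed coeff_Y_closed intro: inj_onD[OF gamma_fun_inj])
  also have "\<dots> = base_coeff p (circle_d p (circle_fun p k))"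
    using coeff_Y_base_coeff[OF h'] k_eq by simp
  finally have "h = circle_d p (circle_fun p k)"
    using h h' by (intro base_coeff_inj circle_d_smooth)
  with h' show "h \<in> circle_d p ` circle_smooth p" by blast
next
  fix \<omega> assume "\<omega> \<in> {\<omega> \<in> leaf_forms1 p. leaf_d1 p \<omega> = 0}"
  then obtain f g where f: "f \<in> coeff_algebra p" and g: "g \<in> coeff_algebra p"
    and \<omega>: "\<omega> = (gamma_fun p f, gamma_fun p g)" and "leaf_d1 p \<omega> = 0"
    by (auto simp: leaf_forms1_def elim!: gamma_algebra_cases)
  hence cocycle: "f - (coeff_Y f - coeff_X g) = 0"
    by (simp add: leaf_d1_gamma_fun gamma_fun_eq_0_iff coeff_diff coeff_X_closed coeff_Y_closed)
  let ?h = "circle_fun p g"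
  have h: "?h \<in> circle_smooth p" by (rule circle_fun_smooth[OF g])
  have "leaf_d0 p (gamma_fun p (coeff_div_X f)) = (gamma_fun p f, gamma_fun p (g - base_coeff p ?h))"
    using cocycle_exact_modulo_base[OF f g cocycle]
    by (simp add: leaf_d0_gamma_fun coeff_div_X_closed[OF f])
  also have "\<dots> = \<omega> - pullback1 p ?h"
    by (simp add: \<omega> pullback1_def pullback0_eq[OF h] gamma_fun_diff[OF g base_coeff_closed[OF h]])
  finally have "\<omega> - pullback1 p ?h \<in> leaf_d0 p ` gamma_algebra p"
    using gamma_fun_in_algebra[OF coeff_div_X_closed[OF f]] by (metis imageI)
  with h show "\<exists>h\<in>circle_smooth p. \<omega> - pullback1 p h \<in> leaf_d0 p ` gamma_algebra p" by blast
qed (simp_all add: pullback1_def pullback0_add pullback0_scale scale_pair_def, simp add: scale_fn_def fun_eq_iff)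

lemma leaf_d1_surj: "gamma_algebra p \<subseteq> leaf_d1 p ` leaf_forms1 p"
proof
  fix \<phi> assume "\<phi> \<in> gamma_algebra p"
  then obtain u where u: "u \<in> coeff_algebra p" "\<phi> = gamma_fun p u" by (rule gamma_algebra_cases)
  obtain f where f: "f \<in> coeff_algebra p" "f - (coeff_Y f - coeff_X (coeff_div_X u)) = u"
    by (rule coeff_d1_surj[OF u(1)])
  let ?g = "coeff_div_X u"
  have g: "?g \<in> coeff_algebra p" by (rule coeff_div_X_closed[OF u(1)])
  have "\<phi> = leaf_d1 p (gamma_fun p f, gamma_fun p ?g)"
    by (simp add: leaf_d1_gamma_fun[OF f(1) g] f(2) u(2))
  moreover have "(gamma_fun p f, gamma_fun p ?g) \<in> leaf_forms1 p"
    by (simp add: leaf_forms1_def gamma_fun_in_algebra f(1) g)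
  ultimately show "\<phi> \<in> leaf_d1 p ` leaf_forms1 p" by blast
qed

lemma cohomology_iso_degree_2:
  "cohomology_iso scale_fn scale_fn pullback2
    circle_forms2 {0} (leaf_forms2 p) (leaf_d1 p ` leaf_forms1 p)"
  unfolding circle_forms2_def leaf_forms2_def
proof (rule cohomology_isoI)
  have B: "is_subgroup (leaf_d1 p ` leaf_forms1 p)"
    by (rule is_subgroup_image[OF leaf_forms1_subgroup]) (rule leaf_d1_diff)
  thus "is_subgroup (leaf_d1 p ` leaf_forms1 p)" .
  show "is_subgroup (gamma_algebra p)" by (rule gamma_algebra_subgroup)
  thus "pullback2 ` {0} \<subseteq> gamma_algebra p" by (simp add: pullback2_def is_subgroup_def)
  show "pullback2 ` {0} \<subseteq> leaf_d1 p ` leaf_forms1 p" 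
    using B by (simp add: pullback2_def is_subgroup_def)
  show "\<exists>u\<in>{0}. \<phi> - pullback2 u \<in> leaf_d1 p ` leaf_forms1 p" if "\<phi> \<in> gamma_algebra p" for \<phi>
    using that leaf_d1_surj by (auto simp: pullback2_def)
qed (auto simp: is_subgroup_def pullback2_def scale_fn_def fun_eq_iff)

end

theorem proposition5p2:
  fixes p :: nat
  assumes "prime p"
  shows "pullback0 p ` circle_smooth p \<subseteq> leaf_forms0 p \<and>
    pullback1 p ` circle_smooth p \<subseteq> leaf_forms1 p \<and>
    (\<forall>h\<in>circle_smooth p. leaf_d0 p (pullback0 p h) = pullback1 p (circle_d p h)) \<and>
    (\<forall>h\<in>circle_smooth p. leaf_d1 p (pullback1 p h) = 0) \<and>
    cohomology_iso scale_fn scale_fn (pullback0 p)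
      {h \<in> circle_smooth p. circle_d p h = 0} {0}
      {f \<in> leaf_forms0 p. leaf_d0 p f = 0} {0} \<and>
    cohomology_iso scale_fn scale_pair (pullback1 p)
      (circle_smooth p) (circle_d p ` circle_smooth p)
      {\<omega> \<in> leaf_forms1 p. leaf_d1 p \<omega> = 0} (leaf_d0 p ` leaf_forms0 p) \<and>
    cohomology_iso scale_fn scale_fn pullback2
      circle_forms2 {0}
      (leaf_forms2 p) (leaf_d1 p ` leaf_forms1 p)"
proof -
  have p: "p > 1" using assms by (rule prime_gt_1_nat)
  show ?thesis
    using cohomology_iso_degree_0[OF p] cohomology_iso_degree_1[OF p] cohomology_iso_degree_2[OF p]
      pullback0_closed[OF p] pullback1_closed[OF p] leaf_d0_pullback0[OF p] leaf_d1_pullback1[OF p]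
    by (auto simp: leaf_forms0_def)
qed

end
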